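(* Consider the case $\mathcal L_-=\mathcal L_{SV}$, $\mathcal L_+=\mathcal L_B$. If $\mathbf W_0$ is supported on $\Omega_-$, then $\mathbf W'_-=(\eta'_-,u'_-):=\mathbf W|_{Q_-}-\mathbf W^\star_{cauchy,-}|_{Q_-}$ (where $\mathbf W$ is the solution of the hybrid problem and $\mathbf W^\star_{cauchy,-}$ is the solution on the whole line of the Saint-Venant equations, both with initial datum $\mathbf W_0$) is the restriction to $\overline{Q}_-$ of the solution of the Cauchy problem $$\mathcal L_{SV}\mathbf V=0\ \text{ in }Q,\qquad \mathbf V(\cdot,0)=H\,\mathcal L^{-1}(r)*GR\,\mathbf W_0\ \text{ in }\Omega .$$
   Context: $\mu>0$, $T>0$, $\Omega=\mathbb R$, $\Omega_-=]-\infty,0[$, $\Omega_+=]0,\infty[$, $Q=\Omega\times]0,T[$, $Q_\pm=\Omega_\pm\times]0,T[$. For $\mathbf W=(\eta,u)$: $\mathcal L_{SV}\mathbf W=(\partial_t\eta+\partial_xu,\ \partial_tu+\partial_x\eta)$ and $\mathcal L_B\mathbf W=(\partial_t\eta+\partial_xu,\ (1-\mu^2\partial_x^2)\partial_tu+\partial_x\eta)$. Hybrid problem: $\partial_t\eta+\partial_xu=0$, $(1-\chi_B\mu^2\partial_x^2)\partial_tu+\partial_x\eta=0$ in $Q$, $\mathbf W(\cdot,0)=\mathbf W_0$ in $\Omega$, with $\chi_B$ the indicator function of the Boussinesq region (here $Q_+$). Equivalently, the restrictions $\mathbf W_\pm=(\eta_\pm,u_\pm)$ of $\mathbf W$ to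 $Q_\pm$ satisfy $\mathcal L_\pm\mathbf W_\pm=0$ in $Q_\pm$, $\mathbf W_\pm(\cdot,0)=\mathbf W_0$ in $\Omega_\pm$, together with $u_-(0,\cdot)=u_+(0,\cdot)$ and $\partial_xu_-(0,\cdot)=\partial_xu_+(0,\cdot)$ in $]0,T[$. $\mathbf W^\star_{cauchy,-}$ solves $\mathcal L_-\mathbf W^\star_{cauchy,-}=0$ on $\mathbb R\times]0,T[$ with initial datum $\mathbf W_0$. The solution of $\mathcal L_{SV}\mathbf V=0$ on $\mathbb R$ with data $(\eta_0,u_0)$ is $\eta=\tfrac12(\eta_0(x-t)+\eta_0(x+t))+\tfrac12(u_0(x-t)-u_0(x+t))$, $u=\tfrac12(\eta_0(x-t)-\eta_0(x+t))+\tfrac12(u_0(x-t)+u_0(x+t))$. Notation: $\lambda_-(s)=s$, $\lambda_+(s)=\sqrt{s^2/(1+\mu^2s^2)}$ (root with positive real part for $\mathrm{Re}\,s>0$), $r(s)=\dfrac{\lambda_-(s)-\lambda_+(s)}{\lambda_-(s)+\lambda_+(s)}$; $G=\mathrm{diag}(-1,1)$; $Rf(x)=f(-x)$ (so $R\mathbf W_0$ is supported in $x\ge0$); $H$ is the Heaviside function, equal to $1$ for $x>0$ and $0$ otherwise; $\mathcal L$ (without subscript) is the Laplace transform on $]0,\infty[$, and $\mathcal L^{-1}(r)*g$ denotes $\mathcal L^{-1}\big(r\,\mathcal L(g)\big)$, taken in the variable $x>0$. Thus the initial datum vanishes for $x<0$ and equals $\big(-\mathcal L^{-1}(r\,\mathcal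 L(R\eta_0)),\ \mathcal L^{-1}(r\,\mathcal L(Ru_0))\big)(x)$ for $x>0$.
   Formalization: Solutions are read as classical (C¹ up to the boundary), the Laplace integrals of RW₀ are assumed to converge for some s, and the velocity u₊ is assumed bounded on Q₊, since without a condition at x→+∞ the hybrid problem has growing extra solutions and "the solution" is undefined. *)

theory Defs
  imports "HOL-Analysis.Analysis"
begin

section \<open>Classical regularity up to the boundary\<close>

text \<open>
  Fields are functions of the position \<open>x\<close> and the time \<open>t\<close>, considered on a closed strip
  \<open>X \<times> [0,T]\<close> where \<open>X\<close> is the line or a closed half-line. Derivatives are taken within the strip:
  they are ordinary partial derivatives inside and one-sided ones on the boundary, as needed for the
  traces at the interface \<open>x = 0\<close>.
\<close>

type_synonym field = "real \<Rightarrow> real \<Rightarrow> real"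

definition Dx :: "real set \<Rightarrow> field \<Rightarrow> field" where
  "Dx X f x t = vector_derivative (\<lambda>y. f y t) (at x within X)"

definition Dt :: "real \<Rightarrow> field \<Rightarrow> field" where
  "Dt T f x t = vector_derivative (\<lambda>s. f x s) (at t within {0..T})"

definition x_C1 :: "real set \<Rightarrow> real \<Rightarrow> field \<Rightarrow> bool" where
  "x_C1 X T f \<longleftrightarrow>
     (\<forall>x\<in>X. \<forall>t\<in>{0..T}. (\<lambda>y. f y t) differentiable (at x within X)) \<and>
     continuous_on (X \<times> {0..T}) (\<lambda>(x, t). Dx X f x t)"

definition t_C1 :: "real set \<Rightarrow> real \<Rightarrow> field \<Rightarrow> bool" where
  "t_C1 X T f \<longleftrightarrow>
     (\<forall>x\<in>X. \<forall>t\<in>{0..T}. (\<lambda>s. f x s) differentiable (at t within {0..T})) \<and>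
     continuous_on (X \<times> {0..T}) (\<lambda>(x, t). Dt T f x t)"

definition C1_strip :: "real set \<Rightarrow> real \<Rightarrow> field \<Rightarrow> bool" where
  "C1_strip X T f \<longleftrightarrow>
     continuous_on (X \<times> {0..T}) (\<lambda>(x, t). f x t) \<and> x_C1 X T f \<and> t_C1 X T f"


section \<open>Saint-Venant and Boussinesq operators\<close>

definition L_SV :: "real set \<Rightarrow> real \<Rightarrow> field \<Rightarrow> field \<Rightarrow> real \<Rightarrow> real \<Rightarrow> real \<times> real" where
  "L_SV X T \<eta> u x t = (Dt T \<eta> x t + Dx X u x t, Dt T u x t + Dx X \<eta> x t)"

definition L_B :: "real \<Rightarrow> real set \<Rightarrow> real \<Rightarrow> field \<Rightarrow> field \<Rightarrow> real \<Rightarrow> real \<Rightarrow> real \<times> real" where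
  "L_B \<mu> X T \<eta> u x t =
     (Dt T \<eta> x t + Dx X u x t,
      Dt T u x t - \<mu>\<^sup>2 * Dx X (Dx X (Dt T u)) x t + Dx X \<eta> x t)"

definition SV_classical :: "real set \<Rightarrow> real \<Rightarrow> field \<Rightarrow> field \<Rightarrow> bool" where
  "SV_classical X T \<eta> u \<longleftrightarrow>
     C1_strip X T \<eta> \<and> C1_strip X T u \<and>
     (\<forall>x\<in>interior X. \<forall>t\<in>{0<..<T}. L_SV X T \<eta> u x t = (0, 0))"

definition B_classical :: "real \<Rightarrow> real set \<Rightarrow> real \<Rightarrow> field \<Rightarrow> field \<Rightarrow> bool" where
  "B_classical \<mu> X T \<eta> u \<longleftrightarrow>
     C1_strip X T \<eta> \<and> C1_strip X T u \<and> x_C1 X T (Dt T u) \<and> x_C1 X T (Dx X (Dt T u)) \<and>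
     (\<forall>x\<in>interior X. \<forall>t\<in>{0<..<T}. L_B \<mu> X T \<eta> u x t = (0, 0))"

definition SV_cauchy ::
    "real \<Rightarrow> (real \<Rightarrow> real) \<times> (real \<Rightarrow> real) \<Rightarrow> field \<times> field \<Rightarrow> bool" where
  "SV_cauchy T W\<^sub>0 W \<longleftrightarrow>
     SV_classical UNIV T (fst W) (snd W) \<and>
     (\<forall>x. fst W x 0 = fst W\<^sub>0 x \<and> snd W x 0 = snd W\<^sub>0 x)"


section \<open>The hybrid problem\<close>

text \<open>
  A solution \<open>W\<close> of the hybrid problem (Saint-Venant for \<open>x < 0\<close>, Boussinesq for \<open>x > 0\<close>) is given
  by its restrictions \<open>(\<eta>m, um)\<close> and \<open>(\<eta>p, up)\<close> to the two sides, each extended continuously to its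
  closed strip. The Boussinesq velocity has to be bounded: since \<open>1 - \<mu>\<^sup>2\<partial>\<^sub>x\<^sup>2\<close> annihilates
  \<open>exp (x / \<mu>)\<close>, some condition at infinity is needed for the problem to be well posed. It holds in
  particular for solutions of bounded energy, by the embedding of \<open>H\<^sup>1\<close> in \<open>L\<^sup>\<infinity>\<close>.
\<close>

definition hybrid_SV_B ::
    "real \<Rightarrow> real \<Rightarrow> (real \<Rightarrow> real) \<times> (real \<Rightarrow> real) \<Rightarrow> field \<times> field \<Rightarrow> field \<times> field \<Rightarrow> bool" where
  "hybrid_SV_B \<mu> T W\<^sub>0 Wm Wp \<longleftrightarrow>
     (let \<eta>m = fst Wm; um = snd Wm; \<eta>p = fst Wp; up = snd Wp in
       SV_classical {..0} T \<eta>m um \<and>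
       B_classical \<mu> {0..} T \<eta>p up \<and>
       (\<exists>C. \<forall>x>0. \<forall>t\<in>{0<..<T}. \<bar>up x t\<bar> \<le> C) \<and>
       (\<forall>x<0. \<eta>m x 0 = fst W\<^sub>0 x \<and> um x 0 = snd W\<^sub>0 x) \<and>
       (\<forall>x>0. \<eta>p x 0 = fst W\<^sub>0 x \<and> up x 0 = snd W\<^sub>0 x) \<and>
       (\<forall>t\<in>{0<..<T}. um 0 t = up 0 t \<and> Dx {..0} um 0 t = Dx {0..} up 0 t))"


section \<open>Laplace transform and the reflected datum\<close>

definition laplace_integrable :: "(real \<Rightarrow> real) \<Rightarrow> complex \<Rightarrow> bool" where
  "laplace_integrable f s \<longleftrightarrow>
     set_integrable lborel {0<..} (\<lambda>x. exp (- s * complex_of_real x) * complex_of_real (f x))"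

definition laplace :: "(real \<Rightarrow> real) \<Rightarrow> complex \<Rightarrow> complex" where
  "laplace f s =
     set_lebesgue_integral lborel {0<..} (\<lambda>x. exp (- s * complex_of_real x) * complex_of_real (f x))"

text \<open>
  A Laplace transform determines its original up to null sets only; continuity on \<open>]0,\<infinity>[\<close> and the
  value \<open>0\<close> for \<open>x \<le> 0\<close> select the representative.
\<close>

definition is_inv_laplace :: "(complex \<Rightarrow> complex) \<Rightarrow> (real \<Rightarrow> real) \<Rightarrow> bool" where
  "is_inv_laplace F f \<longleftrightarrow>
     continuous_on {0<..} f \<and> (\<forall>x\<le>0. f x = 0) \<and>
     (\<exists>c. \<forall>s. Re s > c \<longrightarrow> laplace_integrable f s \<and> laplace f s = F s)"

definition inv_laplace :: "(complex \<Rightarrow> complex) \<Rightarrow> real \<Rightarrow> real" where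
  "inv_laplace F = (THE f. is_inv_laplace F f)"

definition lambda_minus :: "complex \<Rightarrow> complex" where
  "lambda_minus s = s"

text \<open>
  For \<open>Re s > 0\<close> the radicand avoids the negative real axis and \<open>0\<close>, so that the principal root is
  the one with positive real part.
\<close>

definition lambda_plus :: "real \<Rightarrow> complex \<Rightarrow> complex" where
  "lambda_plus \<mu> s = csqrt (s\<^sup>2 / (1 + (complex_of_real \<mu>)\<^sup>2 * s\<^sup>2))"

definition refl_coeff :: "real \<Rightarrow> complex \<Rightarrow> complex" where
  "refl_coeff \<mu> s = (lambda_minus s - lambda_plus \<mu> s) / (lambda_minus s + lambda_plus \<mu> s)"

text \<open>
  \<open>refl_conv \<mu> g\<close> is the convolution of \<open>g\<close> with the inverse transform of \<open>refl_coeff \<mu>\<close>; the latter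
  tends to \<open>1\<close> at infinity, so its inverse transform contains a Dirac mass and is not a function.
\<close>

definition refl_conv :: "real \<Rightarrow> (real \<Rightarrow> real) \<Rightarrow> real \<Rightarrow> real" where
  "refl_conv \<mu> g = inv_laplace (\<lambda>s. refl_coeff \<mu> s * laplace g s)"

definition heaviside :: "real \<Rightarrow> real" where
  "heaviside x = (if x > 0 then 1 else 0)"

definition reflect :: "(real \<Rightarrow> real) \<Rightarrow> real \<Rightarrow> real" where
  "reflect f x = f (- x)"

definition reflected_datum ::
    "real \<Rightarrow> (real \<Rightarrow> real) \<times> (real \<Rightarrow> real) \<Rightarrow> (real \<Rightarrow> real) \<times> (real \<Rightarrow> real)" where
  "reflected_datum \<mu> W\<^sub>0 =
     (let R = map_prod reflect reflect;
          G = (\<lambda>(f, g). ((\<lambda>x. - f x), g));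
          (f, g) = map_prod (refl_conv \<mu>) (refl_conv \<mu>) (G (R W\<^sub>0))
      in ((\<lambda>x. heaviside x * f x), (\<lambda>x. heaviside x * g x)))"

end

theory Submission
  imports Defs
begin

text \<open>
  On the left of the interface the difference of the two solutions is a purely left-going wave, so it is
  determined by its values at \<open>x = 0\<close>. On the right, integrating the Boussinesq equations in time gives
  \<open>\<partial>\<^sub>x\<^sup>2 u = B (B u)\<close> for a Volterra convolution operator \<open>B\<close> with symbol \<open>\<lambda>\<^sub>+\<close>, whose kernel comes from
  the Bessel function \<open>J\<^sub>0 (t / \<mu>) / \<mu>\<close>; boundedness leaves only \<open>\<partial>\<^sub>x u = - B u\<close>. Inserting the traces of the
  Saint-Venant solution into this relation yields \<open>b + m * b = 2 p\<close> for the incoming wave \<open>p\<close> and the trace \<open>b\<close>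
  of \<open>u\<close>, with \<open>m\<close> the Bessel kernel. The resolvent equation \<open>k + m * k = 2 m\<close> solves it as \<open>b - p = p - k * p\<close>,
  and on the transform side it says that \<open>1 - k\<close> has the symbol \<open>r\<close>. Working with convolutions keeps everything
  causal, so that the solution is needed on \<open>[0,T]\<close> only.
\<close>

section \<open>Convolution on a half-line\<close>

text \<open>The solution lives on \<open>[0,T]\<close> only, so no transform in time is available
  for it, whereas the datum is defined through transforms in x. The two meet because waves on the
  left have speed 1: the reflected wave depends on x + t alone, so the kernel acting in time at the
  interface is the one acting in space on the datum. Statements about the traces are therefore
  proved as identities in a commutative ring of causal functions under convolution, and the
  transform is applied only to the fixed kernels and to the datum. In this ring division by s is
  multiplication by \<open>J\<close>, and multiplication by s becomes cancellation of
  \<open>J\<close>. With M the transform of the Bessel kernel, lambda_+ = s M and r = (1 - M) / (1 +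
  M). The signs in G account for the change of direction: the incoming wave p = (\<eta>0 + u0) / 2,
  taken at -x, is right-going, while for x \<le> 0 the solution V shows only its left-going part.
  With data (a, b) this is (b - a) / 2, which equals r applied to p.\<close>

definition conv :: "(real \<Rightarrow> real) \<Rightarrow> (real \<Rightarrow> real) \<Rightarrow> real \<Rightarrow> real" where
  "conv f g t = integral {0..t} (\<lambda>y. f (t - y) * g y)"

text \<open>Extended by zero off the compact triangle, the integrand is Lebesgue integrable on the
  plane, so Fubini applies; the rows and columns are then turned back into gauge integrals.\<close>

lemma integral_triangle_swap:
  fixes F :: "real \<Rightarrow> real \<Rightarrow> real"
  assumes F: "continuous_on {(y, z). 0 \<le> z \<and> z \<le> y \<and> y \<le> t} (\<lambda>(y, z). F y z)"
  shows "integral {0..t} (\<lambda>y. integral {0..y} (F y)) = integral {0..t} (\<lambda>z. integral {z..t} (\<lambda>y. F y z))"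
proof -
  define S where "S = {(y, z). 0 \<le> z \<and> z \<le> y \<and> y \<le> t}"
  define G where "G y z = (if (y, z) \<in> S then F y z else 0)" for y z
  have "S = ({0..t} \<times> {0..t}) \<inter> {p. snd p \<le> fst p}"
    by (auto simp: S_def)
  moreover have "closed {p::real \<times> real. snd p \<le> fst p}"
    by (intro closed_Collect_le continuous_intros)
  ultimately have "compact S"
    by (metis compact_Int_closed compact_Times compact_Icc)
  then have "integrable lborel (\<lambda>p. indicator S p *\<^sub>R (\<lambda>(y, z). F y z) p)"
    using F by (intro borel_integrable_compact) (auto simp: S_def)
  moreover have "(\<lambda>p. indicator S p *\<^sub>R (\<lambda>(y, z). F y z) p) = case_prod G"
    by (auto simp: G_def indicator_def fun_eq_iff)
  ultimately have I: "integrable (lborel \<Otimes>\<^sub>M lborel) (case_prod G)"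
    by (simp add: lborel_prod)
  have row: "(\<integral>z. G y z \<partial>lborel) = (if y \<in> {0..t} then integral {0..y} (F y) else 0)" for y
  proof (cases "y \<in> {0..t}")
    case True
    have "continuous_on {0..y} (F y)"
      using True by (intro continuous_on_compose2[OF F, of "{0..y}" "\<lambda>z. (y, z)", simplified] continuous_intros) auto
    then have "set_integrable lborel {0..y} (F y)"
      by (rule borel_integrable_atLeastAtMost')
    then have "(LINT z:{0..y}|lborel. F y z) = integral {0..y} (F y)"
      by (rule set_borel_integral_eq_integral)
    moreover have "(LINT z:{0..y}|lborel. F y z) = (\<integral>z. G y z \<partial>lborel)"
      unfolding set_lebesgue_integral_def using True
      by (intro Bochner_Integration.integral_cong) (auto simp: G_def S_def indicator_def)
    ultimately show ?thesis using True by simp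
  next
    case False
    then have "G y = (\<lambda>z. 0)" by (auto simp: G_def S_def)
    with False show ?thesis by auto
  qed
  have col: "(\<integral>y. G y z \<partial>lborel) = (if z \<in> {0..t} then integral {z..t} (\<lambda>y. F y z) else 0)" for z
  proof (cases "z \<in> {0..t}")
    case True
    have "continuous_on {z..t} (\<lambda>y. F y z)"
      using True by (intro continuous_on_compose2[OF F, of "{z..t}" "\<lambda>y. (y, z)", simplified] continuous_intros) auto
    then have "set_integrable lborel {z..t} (\<lambda>y. F y z)"
      by (rule borel_integrable_atLeastAtMost')
    then have "(LINT y:{z..t}|lborel. F y z) = integral {z..t} (\<lambda>y. F y z)"
      by (rule set_borel_integral_eq_integral)
    moreover have "(LINT y:{z..t}|lborel. F y z) = (\<integral>y. G y z \<partial>lborel)"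
      unfolding set_lebesgue_integral_def using True
      by (intro Bochner_Integration.integral_cong) (auto simp: G_def S_def indicator_def)
    ultimately show ?thesis using True by simp
  next
    case False
    then have "(\<lambda>y. G y z) = (\<lambda>z. 0)" by (auto simp: G_def S_def)
    with False show ?thesis by auto
  qed
  have eq: "integral\<^sup>L lborel (\<lambda>x. if x \<in> {0..t} then f x else 0) = integral {0..t} f"
    if "integrable lborel (\<lambda>x. if x \<in> {0..t} then f x else 0)" for f :: "real \<Rightarrow> real"
    using has_integral_integral_lborel[OF that] has_integral_restrict_UNIV[of "{0..t}" f]
    by (metis integral_unique)
  have "integrable lborel (\<lambda>y. \<integral>z. G y z \<partial>lborel)"
    using lborel_pair.integrable_fst[OF I] by simp
  moreover have "integrable lborel (\<lambda>z. \<integral>y. G y z \<partial>lborel)"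
    using lborel_pair.integrable_snd[OF I] by simp
  moreover have "(\<integral>z. (\<integral>y. G y z \<partial>lborel) \<partial>lborel) = (\<integral>y. (\<integral>z. G y z \<partial>lborel) \<partial>lborel)"
    by (rule lborel_pair.Fubini_integral[OF I])
  ultimately show ?thesis
    unfolding row col by (metis (no_types) eq)
qed

lemma conv_commute: "conv f g t = conv g f t"
proof -
  have "conv f g t = integral {-t..0} (\<lambda>y. f (t + y) * g (- y))"
    unfolding conv_def
    using Henstock_Kurzweil_Integration.integral_reflect_real[of t 0 "\<lambda>y. f (t - y) * g y"] by simp
  also have "\<dots> = integral {0..t} (\<lambda>y. f y * g (t - y))"
    using integral_shift_real_ivl[of 0 t t "\<lambda>y. f y * g (t - y)"] by (simp add: add.commute)
  finally show ?thesis
    by (simp add: conv_def mult.commute)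
qed

lemma conv_assoc:
  assumes f: "continuous_on {0..t} f" and g: "continuous_on {0..t} g" and h: "continuous_on {0..t} h"
  shows "conv (conv f g) h t = conv f (conv g h) t"
proof -
  have "conv f (conv g h) t = integral {0..t} (\<lambda>y. integral {0..y} (\<lambda>z. f (t - y) * (g (y - z) * h z)))"
    by (simp add: conv_def)
  also have "\<dots> = integral {0..t} (\<lambda>z. integral {z..t} (\<lambda>y. f (t - y) * (g (y - z) * h z)))"
    unfolding case_prod_beta
    by (intro integral_triangle_swap, unfold case_prod_beta)
      (intro continuous_intros continuous_on_compose2[OF f] continuous_on_compose2[OF g] continuous_on_compose2[OF h]; force)
  also have "\<dots> = integral {0..t} (\<lambda>z. conv f g (t - z) * h z)"
  proof (rule integral_cong)
    fix z
    have "integral {z..t} (\<lambda>y. f (t - y) * (g (y - z) * h z)) = integral {z..t} (\<lambda>y. f (t - y) * g (y - z)) * h z"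
      by (simp flip: mult.assoc)
    also have "integral {z..t} (\<lambda>y. f (t - y) * g (y - z)) = integral {0..t - z} (\<lambda>y. f (t - z - y) * g y)"
      using integral_shift_real_ivl[of z z t "\<lambda>y. f (t - y) * g (y - z)"] by (simp add: algebra_simps)
    finally show "integral {z..t} (\<lambda>y. f (t - y) * (g (y - z) * h z)) = conv f g (t - z) * h z"
      by (simp add: conv_def)
  qed
  finally show ?thesis
    by (simp add: conv_def)
qed

lemma continuous_on_conv_integrand:
  fixes f g :: "real \<Rightarrow> real"
  assumes "continuous_on {0..} f" "continuous_on {0..} g"
  shows "continuous_on {0..t} (\<lambda>y. f (t - y) * g y)"
  by (intro continuous_intros continuous_on_compose2[OF assms(1)] continuous_on_compose2[OF assms(2)]) auto

lemma integrable_conv_integrand: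
  fixes f g :: "real \<Rightarrow> real"
  assumes "continuous_on {0..} f" "continuous_on {0..} g"
  shows "(\<lambda>y. f (t - y) * g y) integrable_on {0..t}"
  by (intro integrable_continuous_interval continuous_on_conv_integrand assms)

text \<open>Moves the variable upper limit into the integrand, so that continuity in t follows from
  the continuity of parameter integrals over a fixed interval.\<close>

lemma integral_eq_scaled_unit_integral:
  fixes h :: "real \<Rightarrow> real"
  assumes "continuous_on {0..t} h" "0 \<le> t"
  shows "integral {0..t} h = t * integral (cbox 0 1) (\<lambda>y. h (t * y))"
proof (cases "t = 0")
  case False
  then have t: "t > 0" using assms by auto
  have "(h has_integral integral {0..t} h) {0..t}"
    by (intro integrable_integral integrable_continuous_interval assms)
  from has_integral_stretch_real[OF this False]
  have "((\<lambda>y. h (t * y)) has_integral (1 / t * integral {0..t} h)) ((\<lambda>x. x / t) ` {0..t})"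
    using t by simp
  also have "(\<lambda>x. x / t) ` {0..t} = {0..1}"
    using t by auto
  finally show ?thesis
    using t by (simp add: integral_unique)
qed simp

lemma continuous_on_conv:
  fixes f g :: "real \<Rightarrow> real"
  assumes f: "continuous_on {0..} f" and g: "continuous_on {0..} g"
  shows "continuous_on {0..} (conv f g)"
proof -
  have eq: "t * integral (cbox 0 1) (\<lambda>y. f (t - t * y) * g (t * y)) = conv f g t" if "t \<in> {0..}" for t
    unfolding conv_def using that
    by (subst integral_eq_scaled_unit_integral) (auto intro!: continuous_on_conv_integrand f g)
  have "continuous_on {0..} (\<lambda>t. t * integral (cbox 0 1) (\<lambda>y. f (t - t * y) * g (t * y)))"
    by (intro continuous_intros integral_continuous_on_param, unfold case_prod_beta)
      (intro continuous_intros continuous_on_compose2[OF f] continuous_on_compose2[OF g];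
        auto simp: mult_left_le)
  then show ?thesis
    by (subst (asm) continuous_on_cong[OF refl eq])
qed

lemma continuous_on_integral_upper:
  fixes g :: "real \<Rightarrow> real \<Rightarrow> real"
  assumes g: "continuous_on (X \<times> {0..T}) (\<lambda>(x, t). g x t)"
  shows "continuous_on (X \<times> {0..T}) (\<lambda>(x, t). integral {0..t} (g x))"
proof -
  have eq: "snd p * integral (cbox 0 1) (\<lambda>y. g (fst p) (snd p * y)) = (case p of (x, t) \<Rightarrow> integral {0..t} (g x))"
    if "p \<in> X \<times> {0..T}" for p
  proof -
    have "continuous_on {0..snd p} (g (fst p))"
      using that by (intro continuous_on_compose2[OF g, of _ "\<lambda>t. (fst p, t)", simplified] continuous_intros) auto
    from integral_eq_scaled_unit_integral[OF this] that show ?thesis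
      by (auto simp: case_prod_beta)
  qed
  have "continuous_on (X \<times> {0..T}) (\<lambda>p. snd p * integral (cbox 0 1) (\<lambda>y. g (fst p) (snd p * y)))"
    by (intro continuous_intros integral_continuous_on_param, unfold case_prod_beta)
      (intro continuous_on_compose2[OF g, of _ "\<lambda>p. (fst (fst p), snd (fst p) * snd p)", simplified] continuous_intros;
        auto intro: order_trans[OF mult_right_le_one_le])
  then show ?thesis
    by (subst (asm) continuous_on_cong[OF refl eq])
qed

lemma conv_add_left:
  assumes "continuous_on {0..} f" "continuous_on {0..} g" "continuous_on {0..} h"
  shows "conv (\<lambda>t. f t + g t) h t = conv f h t + conv g h t"
  unfolding conv_def distrib_right
  by (rule integral_add) (intro integrable_conv_integrand assms)+

lemma conv_scale_left: "conv (\<lambda>t. c * f t) g t = c * conv f g t"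
  unfolding conv_def mult.assoc by (rule integral_mult_right)

lemma conv_scale_right: "conv f (\<lambda>t. c * g t) t = c * conv f g t"
  unfolding conv_def mult.left_commute[of _ c] by (rule integral_mult_right)

lemma conv_cong:
  assumes "\<And>y. 0 \<le> y \<Longrightarrow> y \<le> t \<Longrightarrow> f y = f' y" "\<And>y. 0 \<le> y \<Longrightarrow> y \<le> t \<Longrightarrow> g y = g' y"
  shows "conv f g t = conv f' g' t"
  unfolding conv_def by (intro integral_cong) (auto simp: assms)

section \<open>The algebra of causal functions\<close>

text \<open>The value 0 at negative times makes the representative unique, so that agreement on
  \<open>{0..}\<close> becomes equality in a type. A jump at 0 is allowed, since \<open>J\<close>
  and the Bessel kernel have one.\<close>

typedef causal = "{f :: real \<Rightarrow> real. continuous_on {0..} f \<and> (\<forall>t<0. f t = 0)}"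
  morphisms at_time Abs_causal
  by (rule exI[of _ "\<lambda>_. 0"]) auto

setup_lifting type_definition_causal

lemma continuous_on_causal_if:
  "continuous_on {0..} (\<lambda>t::real. if t < 0 then 0 else f t) = continuous_on {0..} (f :: real \<Rightarrow> real)"
  by (rule continuous_on_cong) auto

lift_definition causal :: "(real \<Rightarrow> real) \<Rightarrow> causal" is
  "\<lambda>f. if continuous_on {0..} f then (\<lambda>t. if t < 0 then 0 else f t) else (\<lambda>_. 0)"
  by (auto simp: continuous_on_causal_if)

lemma at_causal: "continuous_on {0..} f \<Longrightarrow> 0 \<le> t \<Longrightarrow> at_time (causal f) t = f t"
  by transfer auto

text \<open>Freezing the value after T gives a continuous extension to all times. The choice is
  harmless: a convolution at time t sees its factors on \<open>[0,t]\<close> only.\<close>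

definition causal_upto :: "real \<Rightarrow> (real \<Rightarrow> real) \<Rightarrow> causal" where
  "causal_upto T f = causal (\<lambda>t. f (min t T))"

lemma at_causal_upto:
  assumes "continuous_on {0..T} f" "0 \<le> t" "t \<le> T"
  shows "at_time (causal_upto T f) t = f t"
proof -
  have "continuous_on {0..} (\<lambda>t. f (min t T))"
    using assms by (intro continuous_on_compose2[OF assms(1)] continuous_intros) auto
  with assms show ?thesis
    by (simp add: causal_upto_def at_causal)
qed

lemma continuous_on_at_time: "continuous_on {0..} (at_time f)"
  by transfer auto

lemma continuous_on_at_time_comp [continuous_intros]:
  assumes "continuous_on X g" "\<And>x. x \<in> X \<Longrightarrow> 0 \<le> g x"
  shows "continuous_on X (\<lambda>x. at_time f (g x))"
  using assms by (intro continuous_on_compose2[OF continuous_on_at_time]) auto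

lemma at_time_neg: "t < 0 \<Longrightarrow> at_time f t = 0"
  by transfer auto

lemma causal_eqI: "(\<And>t. 0 \<le> t \<Longrightarrow> at_time f t = at_time g t) \<Longrightarrow> f = g"
  by transfer (metis ext not_le)

text \<open>The unit for convolution would be a Dirac mass, so the ring has none; multiples of the
  identity operator enter through \<open>scaleR\<close> instead.\<close>

instantiation causal :: "{comm_ring, real_algebra}"
begin

lift_definition zero_causal :: causal is "\<lambda>_. 0" by auto
lift_definition plus_causal :: "causal \<Rightarrow> causal \<Rightarrow> causal" is "\<lambda>f g t. f t + g t"
  by (auto intro!: continuous_intros)
lift_definition minus_causal :: "causal \<Rightarrow> causal \<Rightarrow> causal" is "\<lambda>f g t. f t - g t"
  by (auto intro!: continuous_intros)
lift_definition uminus_causal :: "causal \<Rightarrow> causal" is "\<lambda>f t. - f t"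
  by (auto intro!: continuous_intros)
lift_definition scaleR_causal :: "real \<Rightarrow> causal \<Rightarrow> causal" is "\<lambda>c f t. c * f t"
  by (auto intro!: continuous_intros)
lift_definition times_causal :: "causal \<Rightarrow> causal \<Rightarrow> causal" is conv
  by (auto intro!: continuous_on_conv) (simp add: conv_def)

instance
proof
  fix a b c :: causal and r s :: real
  show "a + b + c = a + (b + c)" "a + b = b + a" "0 + a = a" "- a + a = 0" "a - b = a + - b"
    by (transfer; simp add: add_ac)+
  show "r *\<^sub>R (a + b) = r *\<^sub>R a + r *\<^sub>R b" "(r + s) *\<^sub>R a = r *\<^sub>R a + s *\<^sub>R a"
    "r *\<^sub>R s *\<^sub>R a = (r * s) *\<^sub>R a" "1 *\<^sub>R a = a"
    by (transfer; simp add: algebra_simps)+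
  show "a * b * c = a * (b * c)"
    by transfer (intro ext conv_assoc; auto elim: continuous_on_subset)
  show **: "a * b = b * a" for a b :: causal
    by transfer (intro ext conv_commute)
  show *: "(a + b) * c = a * c + b * c" for a b c :: causal
    by transfer (intro ext conv_add_left; simp)
  show "a * (b + c) = a * b + a * c"
    using *[of b c a] by (simp add: **)
  show "(r *\<^sub>R a) * b = r *\<^sub>R (a * b)" "a * (r *\<^sub>R b) = r *\<^sub>R (a * b)"
    by (transfer, intro ext conv_scale_left conv_scale_right)+
qed

end

lemma at_time_simps [simp]:
  "at_time 0 t = 0"
  "at_time (f + g) t = at_time f t + at_time g t"
  "at_time (f - g) t = at_time f t - at_time g t"
  "at_time (- f) t = - at_time f t"
  "at_time (c *\<^sub>R f) t = c * at_time f t"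
  by (transfer; simp)+

lemma at_time_mult: "at_time (f * g) t = conv (at_time f) (at_time g) t"
  by transfer simp

lemma at_time_mult_0 [simp]: "at_time (f * g) 0 = 0"
  by (simp add: at_time_mult conv_def)

text \<open>The Heaviside function with value 1 at 0. Multiplying by it is integration from 0, that
  is, division by s on the transform side.\<close>

definition J :: causal where "J = causal (\<lambda>_. 1)"

lemma at_J: "0 \<le> t \<Longrightarrow> at_time J t = 1"
  by (simp add: J_def at_causal)

lemma at_J_mult: "at_time (J * f) t = integral {0..t} (at_time f)"
  unfolding at_time_mult conv_def by (intro integral_cong) (simp add: at_J)

lemma at_J_J: "0 \<le> t \<Longrightarrow> at_time (J * J) t = t"
  unfolding at_J_mult using integral_cong[of "{0..t}" "at_time J" "\<lambda>_. 1"] by (simp add: at_J)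

lemma J_mult_has_derivative:
  assumes "0 \<le> t" "t \<le> b"
  shows "(at_time (J * f) has_vector_derivative at_time f t) (at t within {0..b})"
  unfolding at_J_mult
  by (intro integral_has_vector_derivative continuous_on_at_time_comp continuous_intros) (use assms in auto)

lemma J_mult_eqI:
  assumes "\<And>t. 0 < t \<Longrightarrow> (at_time g has_real_derivative at_time f t) (at t)" "at_time g 0 = 0"
  shows "J * f = g"
proof (rule causal_eqI)
  fix t :: real assume "0 \<le> t"
  then have "(at_time f has_integral (at_time g t - at_time g 0)) {0..t}"
    by (intro fundamental_theorem_of_calculus_interior continuous_intros)
      (auto intro: assms(1)[unfolded has_real_derivative_iff_has_vector_derivative])
  then show "at_time (J * f) t = at_time g t"
    by (simp add: at_J_mult assms(2) integral_unique)
qed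

text \<open>Differentiating \<open>J * f\<close> gives back f. This cancellation law stands in for
  multiplication by s, which is not an operation of the ring.\<close>

lemma J_mult_eq_0:
  assumes "J * f = 0"
  shows "f = 0"
proof (rule causal_eqI)
  fix t :: real assume t: "0 \<le> t"
  have "((\<lambda>_. 0) has_vector_derivative at_time f t) (at t within {0..t + 1})"
    using J_mult_has_derivative[of t "t + 1" f] t
    unfolding assms at_time_simps(1)[abs_def] by simp
  moreover have "((\<lambda>_::real. 0::real) has_vector_derivative 0) (at t within {0..t + 1})"
    by simp
  ultimately have "at_time f t = 0"
    using t by (intro vector_derivative_unique_within_closed_interval[of 0 "t + 1" t]) auto
  then show "at_time f t = at_time 0 t" by simp
qed

section \<open>Multiplication by time, the counterpart of -d/ds\<close>

lift_definition mult_t :: "causal \<Rightarrow> causal" is "\<lambda>f t. t * f t"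
  by (auto intro!: continuous_intros)

lemma at_mult_t [simp]: "at_time (mult_t f) t = t * at_time f t"
  by transfer simp

lemma mult_t_add [simp]: "mult_t (f + g) = mult_t f + mult_t g"
  by (rule causal_eqI) (simp add: algebra_simps)

lemma mult_t_scaleR [simp]: "mult_t (c *\<^sub>R f) = c *\<^sub>R mult_t f"
  by (rule causal_eqI) simp

text \<open>Under the convolution integral t = (t - y) + y; on the transform side this is the
  product rule.\<close>

lemma mult_t_mult: "mult_t (f * g) = mult_t f * g + f * mult_t g"
proof (rule causal_eqI)
  fix t :: real assume t: "0 \<le> t"
  have *: "t * conv (at_time f) (at_time g) t =
      integral {0..t} (\<lambda>y. (t - y) * at_time f (t - y) * at_time g y + at_time f (t - y) * (y * at_time g y))"
    unfolding conv_def by (subst integral_mult_right[symmetric]) (simp add: algebra_simps)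
  show "at_time (mult_t (f * g)) t = at_time (mult_t f * g + f * mult_t g) t"
    unfolding at_time_simps at_mult_t at_time_mult *
    unfolding conv_def at_mult_t
    by (intro integral_add integrable_continuous_interval continuous_intros) auto
qed

lemma mult_t_J: "mult_t J = J * J"
  by (rule causal_eqI) (simp add: at_J at_J_J)

section \<open>The Bessel kernel\<close>

text \<open>The hypothesis makes f(t) the mean of f over \<open>[0,t]\<close>. Hence f is
  differentiable for t > 0, and the quotient rule for \<open>(J * f) / t\<close> gives (t f -
  \<open>J * f\<close>) / t^2 = 0.\<close>

lemma eq_J_if_mult_t_eq:
  assumes "mult_t f = J * f" "at_time f 0 = 1"
  shows "f = J"
proof (rule causal_eqI)
  fix t :: real assume "0 \<le> t"
  moreover have "at_time f t = 1" if t: "0 < t"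
  proof -
    have "(at_time f has_real_derivative 0) (at s)" if s: "0 < s" for s
    proof -
      have eq: "at_time (J * f) x = x * at_time f x" for x
        using at_mult_t[of f x] assms by simp
      have "(at_time (J * f) has_vector_derivative at_time f s) (at s within {0..s + 1})"
        using s by (intro J_mult_has_derivative) auto
      then have "(at_time (J * f) has_real_derivative at_time f s) (at s)"
        using s by (simp add: has_real_derivative_iff_has_vector_derivative at_within_Icc_at)
      then have "((\<lambda>x. at_time (J * f) x / x) has_real_derivative (at_time f s * s - at_time (J * f) s * 1) / (s * s)) (at s)"
        using s by (intro DERIV_divide) auto
      then have "((\<lambda>x. at_time (J * f) x / x) has_real_derivative 0) (at s)"
        by (simp add: eq)
      then show ?thesis
        by (rule has_field_derivative_transform_within_open[of _ _ _ "{0<..}"])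
          (use s in \<open>auto simp: eq\<close>)
    qed
    then have "at_time f t = at_time f 0"
      using t by (intro DERIV_isconst_end[of 0 t]) (auto intro!: continuous_intros)
    with assms show ?thesis by simp
  qed
  ultimately show "at_time f t = at_time J t"
    using assms(2) by (cases "t = 0") (auto simp: at_J)
qed

text \<open>Bessel's integral for J_0 at t / \<mu>, divided by \<mu>; the transform is 1 / sqrt (1 +
  \<mu>^2 s^2). The primed functions below are its first two derivatives, taken under the integral
  sign.\<close>

definition bessel_fun :: "real \<Rightarrow> real \<Rightarrow> real" where
  "bessel_fun \<mu> t = integral {0..pi} (\<lambda>\<theta>. cos (t * cos \<theta> / \<mu>)) / (pi * \<mu>)"

definition bessel_fun' :: "real \<Rightarrow> real \<Rightarrow> real" where
  "bessel_fun' \<mu> t = - integral {0..pi} (\<lambda>\<theta>. cos \<theta> * sin (t * cos \<theta> / \<mu>)) / (pi * \<mu>\<^sup>2)"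

definition bessel_fun'' :: "real \<Rightarrow> real \<Rightarrow> real" where
  "bessel_fun'' \<mu> t = - integral {0..pi} (\<lambda>\<theta>. (cos \<theta>)\<^sup>2 * cos (t * cos \<theta> / \<mu>)) / (pi * \<mu> ^ 3)"

lemma DERIV_bessel_fun:
  assumes "\<mu> > 0"
  shows "(bessel_fun \<mu> has_real_derivative bessel_fun' \<mu> t) (at t)"
proof -
  have "((\<lambda>t. integral (cbox 0 pi) (\<lambda>\<theta>. cos (t * cos \<theta> / \<mu>))) has_real_derivative
      integral (cbox 0 pi) (\<lambda>\<theta>. - (cos \<theta> * sin (t * cos \<theta> / \<mu>)) / \<mu>)) (at t within UNIV)"
    using assms by (intro leibniz_rule_field_derivative)
      (auto intro!: derivative_eq_intros integrable_continuous_interval continuous_intros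
        simp: case_prod_beta)
  then have "((\<lambda>t. integral {0..pi} (\<lambda>\<theta>. cos (t * cos \<theta> / \<mu>)) / (pi * \<mu>)) has_real_derivative
      (- integral {0..pi} (\<lambda>\<theta>. cos \<theta> * sin (t * cos \<theta> / \<mu>)) / \<mu>) / (pi * \<mu>)) (at t)"
    by (intro DERIV_cdivide) simp
  then show ?thesis
    using assms by (simp add: bessel_fun_def[abs_def] bessel_fun'_def power2_eq_square mult.left_commute)
qed

lemma DERIV_bessel_fun':
  assumes "\<mu> > 0"
  shows "(bessel_fun' \<mu> has_real_derivative bessel_fun'' \<mu> t) (at t)"
proof -
  have "((\<lambda>t. integral (cbox 0 pi) (\<lambda>\<theta>. cos \<theta> * sin (t * cos \<theta> / \<mu>))) has_real_derivative
      integral (cbox 0 pi) (\<lambda>\<theta>. (cos \<theta>)\<^sup>2 * cos (t * cos \<theta> / \<mu>) / \<mu>)) (at t within UNIV)"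
    using assms by (intro leibniz_rule_field_derivative)
      (auto intro!: derivative_eq_intros integrable_continuous_interval continuous_intros
        simp: case_prod_beta power2_eq_square)
  then have "((\<lambda>t. - integral {0..pi} (\<lambda>\<theta>. cos \<theta> * sin (t * cos \<theta> / \<mu>)) / (pi * \<mu>\<^sup>2)) has_real_derivative
      (- (integral {0..pi} (\<lambda>\<theta>. (cos \<theta>)\<^sup>2 * cos (t * cos \<theta> / \<mu>)) / \<mu>)) / (pi * \<mu>\<^sup>2)) (at t)"
    by (intro DERIV_cdivide DERIV_minus) simp
  then show ?thesis
    using assms by (simp add: bessel_fun'_def[abs_def] bessel_fun''_def power2_eq_square power3_eq_cube mult_ac)
qed

text \<open>The derivative of sin \<theta> sin (y cos \<theta>) integrates to zero over
  \<open>{0..pi}\<close>, because sin vanishes at both ends; replacing sin^2 by 1 - cos^2 expresses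
  that integral through the three Bessel integrals. The result is Bessel's equation in the form
  \<mu>^2 (t w')' = - t w.\<close>

lemma bessel_ode:
  assumes "\<mu> > 0"
  shows "\<mu>\<^sup>2 * (bessel_fun' \<mu> t + t * bessel_fun'' \<mu> t) = - t * bessel_fun \<mu> t"
proof -
  define y where "y = t / \<mu>"
  define C where "C = integral {0..pi} (\<lambda>\<theta>. cos (t * cos \<theta> / \<mu>))"
  define S where "S = integral {0..pi} (\<lambda>\<theta>. cos \<theta> * sin (t * cos \<theta> / \<mu>))"
  define CC where "CC = integral {0..pi} (\<lambda>\<theta>. (cos \<theta>)\<^sup>2 * cos (t * cos \<theta> / \<mu>))"
  have y: "t * c / \<mu> = y * c" for c by (simp add: y_def)
  have "((\<lambda>\<theta>. cos \<theta> * sin (y * cos \<theta>) - y * ((sin \<theta>)\<^sup>2 * cos (y * cos \<theta>))) has_integral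
      (sin pi * sin (y * cos pi) - sin 0 * sin (y * cos 0))) {0..pi}"
  proof (rule fundamental_theorem_of_calculus)
    fix \<theta> :: real
    have "((\<lambda>\<theta>. sin \<theta> * sin (y * cos \<theta>)) has_real_derivative
        (cos \<theta> * sin (y * cos \<theta>) + sin \<theta> * (cos (y * cos \<theta>) * (y * - sin \<theta>)))) (at \<theta> within {0..pi})"
      by (auto intro!: derivative_eq_intros)
    then show "((\<lambda>\<theta>. sin \<theta> * sin (y * cos \<theta>)) has_vector_derivative
        (cos \<theta> * sin (y * cos \<theta>) - y * ((sin \<theta>)\<^sup>2 * cos (y * cos \<theta>)))) (at \<theta> within {0..pi})"
      by (simp add: has_real_derivative_iff_has_vector_derivative power2_eq_square mult_ac)
  qed simp
  then have "((\<lambda>\<theta>. cos \<theta> * sin (y * cos \<theta>) - y * (cos (y * cos \<theta>) - (cos \<theta>)\<^sup>2 * cos (y * cos \<theta>))) has_integral 0) {0..pi}"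
    by (simp add: sin_squared_eq algebra_simps)
  moreover have "((\<lambda>\<theta>. cos \<theta> * sin (y * cos \<theta>) - y * (cos (y * cos \<theta>) - (cos \<theta>)\<^sup>2 * cos (y * cos \<theta>))) has_integral
      (S - y * (C - CC))) {0..pi}"
    unfolding S_def C_def CC_def y
    by (intro has_integral_diff has_integral_mult_right integrable_integral integrable_continuous_interval continuous_intros)
  ultimately have "S - y * (C - CC) = 0"
    by (rule has_integral_unique[rotated])
  then have S: "S + y * CC = y * C"
    by (simp add: algebra_simps)
  have "\<mu>\<^sup>2 * (- S / (pi * \<mu>\<^sup>2) + t * (- CC / (pi * \<mu> ^ 3))) = - (S + y * CC) / pi"
    using assms by (simp add: y_def field_simps power2_eq_square power3_eq_cube)
  also have "\<dots> = - t * (C / (pi * \<mu>))"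
    unfolding S by (simp add: y_def)
  finally show ?thesis
    by (simp add: bessel_fun_def bessel_fun'_def bessel_fun''_def C_def S_def CC_def)
qed

lemma abs_bessel_fun'_le:
  assumes "\<mu> > 0"
  shows "\<bar>bessel_fun' \<mu> t\<bar> \<le> 1 / \<mu>\<^sup>2"
proof -
  have "norm (integral {0..pi} (\<lambda>\<theta>. cos \<theta> * sin (t * cos \<theta> / \<mu>))) \<le> 1 * (pi - 0)"
  proof (rule integral_bound)
    fix \<theta> :: real
    have "\<bar>cos \<theta>\<bar> * \<bar>sin (t * cos \<theta> / \<mu>)\<bar> \<le> 1 * 1"
      by (intro mult_mono) auto
    then show "norm (cos \<theta> * sin (t * cos \<theta> / \<mu>)) \<le> 1"
      by (simp add: abs_mult)
  qed (use assms in \<open>auto intro!: continuous_intros\<close>)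
  then show ?thesis
    using assms by (simp add: bessel_fun'_def abs_mult field_simps)
qed

section \<open>The Bessel kernel as an element of the causal ring\<close>

definition bessel :: "real \<Rightarrow> causal" where "bessel \<mu> = causal (bessel_fun \<mu>)"
definition bessel' :: "real \<Rightarrow> causal" where "bessel' \<mu> = causal (bessel_fun' \<mu>)"

context
  fixes \<mu> :: real
  assumes mu: "\<mu> > 0"
begin

lemma at_bessel: "0 \<le> t \<Longrightarrow> at_time (bessel \<mu>) t = bessel_fun \<mu> t"
  unfolding bessel_def
  by (intro at_causal continuous_at_imp_continuous_on ballI DERIV_isCont[OF DERIV_bessel_fun[OF mu]])

lemma at_bessel': "0 \<le> t \<Longrightarrow> at_time (bessel' \<mu>) t = bessel_fun' \<mu> t"
  unfolding bessel'_def
  by (intro at_causal continuous_at_imp_continuous_on ballI DERIV_isCont[OF DERIV_bessel_fun'[OF mu]])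

lemma abs_bessel'_le: "\<bar>at_time (bessel' \<mu>) t\<bar> \<le> 1 / \<mu>\<^sup>2"
  by (cases "t < 0") (simp_all add: at_time_neg at_bessel' abs_bessel_fun'_le[OF mu])

lemma at_bessel_0: "at_time (bessel \<mu>) 0 = 1 / \<mu>"
  using mu by (simp add: at_bessel bessel_fun_def)

lemma J_mult_bessel': "J * bessel' \<mu> = bessel \<mu> - (1 / \<mu>) *\<^sub>R J"
proof (rule J_mult_eqI)
  fix t :: real assume t: "t > 0"
  have "((\<lambda>t. bessel_fun \<mu> t - 1 / \<mu>) has_real_derivative at_time (bessel' \<mu>) t) (at t)"
    using t by (auto intro!: derivative_eq_intros DERIV_bessel_fun[OF mu] simp: at_bessel')
  then show "(at_time (bessel \<mu> - (1 / \<mu>) *\<^sub>R J) has_real_derivative at_time (bessel' \<mu>) t) (at t)"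
    by (rule has_field_derivative_transform_within_open[of _ _ _ "{0<..}"])
      (use t in \<open>auto simp: at_bessel at_J\<close>)
qed (simp add: at_bessel_0 at_J)

lemma J_mult_mult_t_bessel: "J * mult_t (bessel \<mu>) = - (\<mu>\<^sup>2 *\<^sub>R mult_t (bessel' \<mu>))"
proof (rule J_mult_eqI)
  fix t :: real assume t: "t > 0"
  have "((\<lambda>t. - (\<mu>\<^sup>2 * (t * bessel_fun' \<mu> t))) has_real_derivative
      - (\<mu>\<^sup>2 * (bessel_fun' \<mu> t + t * bessel_fun'' \<mu> t))) (at t)"
    by (auto intro!: derivative_eq_intros DERIV_bessel_fun'[OF mu])
  then have "((\<lambda>t. - (\<mu>\<^sup>2 * (t * bessel_fun' \<mu> t))) has_real_derivative at_time (mult_t (bessel \<mu>)) t) (at t)"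
    using t by (simp add: bessel_ode[OF mu] at_bessel)
  then show "(at_time (- (\<mu>\<^sup>2 *\<^sub>R mult_t (bessel' \<mu>))) has_real_derivative at_time (mult_t (bessel \<mu>)) t) (at t)"
    by (rule has_field_derivative_transform_within_open[of _ _ _ "{0<..}"])
      (use t in \<open>auto simp: at_bessel'\<close>)
qed simp

text \<open>
  In terms of the transform \<open>M\<close> of the kernel this is \<open>M\<^sup>2 (1 + \<mu>\<^sup>2 s\<^sup>2) = 1\<close>. Bessel's equation makes
  the left-hand side \<open>J * D\<close> satisfy \<open>t D = \<integral> D\<close>, and multiplication by \<open>t\<close> is a derivation.
\<close>

lemma bessel_square:
  "\<mu>\<^sup>2 *\<^sub>R (bessel \<mu> * bessel \<mu>) + J * J * (bessel \<mu> * bessel \<mu>) = J * J"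
proof -
  define m where "m = bessel \<mu>"
  define n where "n = bessel' \<mu>"
  \<comment> \<open>The time derivative of the left-hand side: that of m * m is n * m + m / \<mu>,
    because m starts at 1 / \<mu>. At t = 0 only the term \<mu> m survives, with value 1.\<close>
  define D where "D = \<mu>\<^sup>2 *\<^sub>R (n * m) + \<mu> *\<^sub>R m + J * m * m"
  have Jn: "J * n = m - (1 / \<mu>) *\<^sub>R J"
    unfolding m_def n_def by (rule J_mult_bessel')
  have Jm: "J * mult_t m = - (\<mu>\<^sup>2 *\<^sub>R mult_t n)"
    unfolding m_def n_def by (rule J_mult_mult_t_bessel)
  have "mult_t (J * n) = mult_t m - (1 / \<mu>) *\<^sub>R (J * J)"
    unfolding Jn by (rule causal_eqI) (simp add: at_J at_J_J algebra_simps)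
  then have "J * mult_t n = mult_t m - (1 / \<mu>) *\<^sub>R (J * J) - J * (J * n)"
    by (simp add: mult_t_mult mult_t_J algebra_simps)
  also have "\<dots> = mult_t m - J * m"
    unfolding Jn by (simp add: algebra_simps)
  finally have Jtn: "J * mult_t n = mult_t m - J * m" .
  have "J * (J * mult_t m) = - (\<mu>\<^sup>2 *\<^sub>R (J * mult_t n))"
    unfolding Jm by simp
  \<comment> \<open>Bessel's equation once more: for the transform M of m it reads (1 + \<mu>^2 s^2)
    M' = - \<mu>^2 s M.\<close>
  then have B: "\<mu>\<^sup>2 *\<^sub>R mult_t m + J * J * mult_t m = \<mu>\<^sup>2 *\<^sub>R (J * m)"
    unfolding Jtn by (simp add: algebra_simps)
  have E: "J * D = \<mu>\<^sup>2 *\<^sub>R (m * m) + J * J * (m * m)"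
  proof -
    have "J * D = \<mu>\<^sup>2 *\<^sub>R ((J * n) * m) + \<mu> *\<^sub>R (J * m) + J * J * (m * m)"
      by (simp add: D_def algebra_simps)
    also have "\<mu>\<^sup>2 *\<^sub>R ((J * n) * m) + \<mu> *\<^sub>R (J * m) = \<mu>\<^sup>2 *\<^sub>R (m * m)"
      unfolding Jn using mu by (simp add: algebra_simps power2_eq_square)
    finally show ?thesis .
  qed
  \<comment> \<open>Half of what \<open>mult_t\<close> makes of \<open>J * D\<close>: the derivation
    meets the two equal factors m, and the two equal factors J, symmetrically, so each contribution
    occurs twice.\<close>
  define X where "X = m * (\<mu>\<^sup>2 *\<^sub>R mult_t m + J * J * mult_t m) + J * J * J * (m * m)"
  have "mult_t (J * D) = X + X"
    unfolding E X_def by (simp add: mult_t_mult mult_t_J algebra_simps)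
  also have "X = J * (J * D)"
    unfolding X_def B E by (simp add: algebra_simps)
  finally have "J * mult_t D = J * (J * D)"
    by (simp add: mult_t_mult mult_t_J algebra_simps)
  then have "J * (mult_t D - J * D) = 0"
    by (simp add: algebra_simps)
  then have "mult_t D = J * D"
    using J_mult_eq_0 by fastforce
  moreover have "at_time D 0 = 1"
    using mu by (simp add: D_def m_def at_bessel_0)
  ultimately have "D = J"
    by (rule eq_J_if_mult_t_eq)
  with E show ?thesis
    by (simp add: m_def)
qed

end

text \<open>The resolvent kernel in closed form. Its transform has to be 1 - r = 2 M / (1 + M);
  expanding the fraction by 1 - M and using M^2 (1 + \<mu>^2 s^2) = 1 turns this into 2 M + (2 /
  \<mu>^2) (M - 1) / s^2, where every term is the transform of a continuous function.\<close>

definition refl_kernel :: "real \<Rightarrow> causal" where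
  "refl_kernel \<mu> = 2 *\<^sub>R bessel \<mu> + (2 / \<mu>\<^sup>2) *\<^sub>R (J * J * bessel \<mu> - J * J)"

lemma refl_kernel_eq:
  assumes mu: "\<mu> > 0"
  shows "refl_kernel \<mu> + bessel \<mu> * refl_kernel \<mu> = 2 *\<^sub>R bessel \<mu>"
proof -
  define m where "m = bessel \<mu>"
  have "m * refl_kernel \<mu> = (2 / \<mu>\<^sup>2) *\<^sub>R (\<mu>\<^sup>2 *\<^sub>R (m * m) + J * J * (m * m)) - (2 / \<mu>\<^sup>2) *\<^sub>R (J * J * m)"
    using mu by (simp add: refl_kernel_def algebra_simps flip: m_def)
  also have "\<mu>\<^sup>2 *\<^sub>R (m * m) + J * J * (m * m) = J * J"
    unfolding m_def by (rule bessel_square[OF mu])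
  finally show ?thesis
    by (simp add: refl_kernel_def algebra_simps flip: m_def)
qed

text \<open>The operator with symbol \<open>\<lambda>\<^sub>+\<close>; it maps the boundary values of \<open>u\<close> to those of \<open>- \<partial>\<^sub>x u\<close>.\<close>

definition dtn :: "real \<Rightarrow> causal \<Rightarrow> causal" where
  "dtn \<mu> f = (1 / \<mu>) *\<^sub>R f + bessel' \<mu> * f"

text \<open>The operator \<open>dtn\<close> is the time derivative of convolution with the Bessel
  kernel, so its symbol is s M; the leading coefficient 1 / \<mu> is the jump of that kernel at
  0.\<close>

lemma J_mult_dtn: "\<mu> > 0 \<Longrightarrow> J * dtn \<mu> f = bessel \<mu> * f"
  using arg_cong[OF J_mult_bessel', of \<mu> "\<lambda>g. g * f"] by (simp add: dtn_def algebra_simps)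

text \<open>On the transform side, lambda_+ squared times \<mu>^2 + 1 / s^2 is 1. The hypothesis is
  the form that the Boussinesq equations take after integration in time from zero data, with a in
  the role of the second x-derivative of u.\<close>

lemma dtn_dtn:
  assumes mu: "\<mu> > 0" and u: "u = \<mu>\<^sup>2 *\<^sub>R a + J * J * a"
  shows "dtn \<mu> (dtn \<mu> u) = a"
proof -
  have "J * (J * dtn \<mu> (dtn \<mu> u)) = J * (bessel \<mu> * dtn \<mu> u)"
    unfolding J_mult_dtn[OF mu] ..
  also have "\<dots> = bessel \<mu> * (J * dtn \<mu> u)"
    by (rule mult.left_commute)
  also have "\<dots> = (\<mu>\<^sup>2 *\<^sub>R (bessel \<mu> * bessel \<mu>) + J * J * (bessel \<mu> * bessel \<mu>)) * a"
    unfolding J_mult_dtn[OF mu] u by (simp add: algebra_simps)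
  finally have "J * (J * dtn \<mu> (dtn \<mu> u)) = J * J * a"
    unfolding bessel_square[OF mu] .
  then have "J * (J * (dtn \<mu> (dtn \<mu> u) - a)) = 0"
    by (simp add: algebra_simps)
  from J_mult_eq_0[OF J_mult_eq_0[OF this]] show ?thesis
    by simp
qed

section \<open>Bounded solutions of the Boussinesq equations on the half-line\<close>

text \<open>By the integrating factor, exp (- c y) (z + F / c) is nonincreasing; since z is bounded
  it tends to 0 at infinity, hence it is nonnegative at x.\<close>

lemma bounded_growth_lower_bound:
  fixes z f :: "real \<Rightarrow> real"
  assumes deriv: "\<And>y. x \<le> y \<Longrightarrow> (z has_real_derivative (c * z y + f y)) (at y)"
    and f: "\<And>y. x \<le> y \<Longrightarrow> f y \<le> F" and bd: "\<And>y. x \<le> y \<Longrightarrow> \<bar>z y\<bar> \<le> M" and c: "c > 0"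
  shows "- F / c \<le> z x"
proof -
  define G where "G y = exp (- (c * y)) * (z y + F / c)" for y
  have "(G has_real_derivative exp (- (c * y)) * (f y - F)) (at y)" if "x \<le> y" for y
    unfolding G_def using c
    by (auto intro!: derivative_eq_intros deriv[OF that] simp: algebra_simps)
  moreover have "exp (- (c * y)) * (f y - F) \<le> 0" if "x \<le> y" for y
    using f[OF that] by (simp add: mult_le_0_iff)
  ultimately have le: "G y \<le> G x" if "x \<le> y" for y
    using that by (intro DERIV_nonpos_imp_nonincreasing[of x y]) auto
  have "(G \<longlongrightarrow> 0) at_top"
  proof (rule tendsto_rabs_zero_cancel[OF tendsto_sandwich])
    show "\<forall>\<^sub>F y in at_top. 0 \<le> \<bar>G y\<bar>" by simp
    show "\<forall>\<^sub>F y in at_top. \<bar>G y\<bar> \<le> exp (- (c * y)) * (M + \<bar>F / c\<bar>)"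
      using eventually_ge_at_top[of x]
    proof eventually_elim
      case (elim y)
      have "\<bar>z y + F / c\<bar> \<le> M + \<bar>F / c\<bar>"
        using bd[OF elim] by linarith
      then show ?case
        unfolding G_def abs_mult by (simp add: mult_left_mono)
    qed
    have "filterlim (\<lambda>y. - (c * y)) at_bot at_top"
      unfolding filterlim_uminus_at_bot minus_minus
      by (rule filterlim_tendsto_pos_mult_at_top[OF tendsto_const c filterlim_ident])
    then have "((\<lambda>y. exp (- (c * y))) \<longlongrightarrow> 0) at_top"
      by (rule filterlim_compose[OF exp_at_bot])
    then show "((\<lambda>y. exp (- (c * y)) * (M + \<bar>F / c\<bar>)) \<longlongrightarrow> 0) at_top"
      by (rule tendsto_mult_left_zero)
  qed simp
  moreover have "\<forall>\<^sub>F y in at_top. G y \<le> G x"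
    using eventually_ge_at_top[of x] by eventually_elim (rule le)
  ultimately have "0 \<le> G x"
    by (rule tendsto_upperbound) simp
  then show ?thesis
    by (simp add: G_def zero_le_mult_iff)
qed

lemma bounded_growth_abs_bound:
  fixes z f :: "real \<Rightarrow> real"
  assumes deriv: "\<And>y. x \<le> y \<Longrightarrow> (z has_real_derivative (c * z y + f y)) (at y)"
    and f: "\<And>y. x \<le> y \<Longrightarrow> \<bar>f y\<bar> \<le> F" and bd: "\<And>y. x \<le> y \<Longrightarrow> \<bar>z y\<bar> \<le> M" and c: "c > 0"
  shows "\<bar>z x\<bar> \<le> F / c"
proof -
  have "- F / c \<le> z x"
    by (rule bounded_growth_lower_bound[OF deriv _ bd c]) (use f in \<open>auto intro: abs_le_D1\<close>)
  moreover have "- F / c \<le> - z x"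
  proof (rule bounded_growth_lower_bound[where z = "\<lambda>y. - z y" and f = "\<lambda>y. - f y"])
    show "((\<lambda>y. - z y) has_real_derivative c * - z y + - f y) (at y)" if "x \<le> y" for y
      using DERIV_minus[OF deriv[OF that]] by simp
  qed (use f bd c in \<open>auto intro: abs_le_D2\<close>)
  ultimately show ?thesis by (simp add: abs_le_iff minus_le_iff)
qed

section \<open>Weighted estimates in time for the Dirichlet-to-Neumann operator\<close>

lemma at_dtn: "at_time (dtn \<mu> f) t = at_time f t / \<mu> + at_time (bessel' \<mu> * f) t"
  by (simp add: dtn_def)

lemma dtn_add: "dtn \<mu> (f + g) = dtn \<mu> f + dtn \<mu> g"
  by (simp add: dtn_def algebra_simps)

text \<open>
  The weight \<open>exp (2 t / \<mu>)\<close> makes the convolution part of the operator half as large as its leading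
  part \<open>1 / \<mu>\<close>.
\<close>

lemma abs_bessel'_mult_le:
  assumes mu: "\<mu> > 0" and f: "\<And>y. 0 \<le> y \<Longrightarrow> y \<le> t \<Longrightarrow> \<bar>at_time f y\<bar> \<le> S * exp (2 * y / \<mu>)" and t: "0 \<le> t"
  shows "\<bar>at_time (bessel' \<mu> * f) t\<bar> \<le> S * exp (2 * t / \<mu>) / (2 * \<mu>)"
proof -
  have S: "0 \<le> S"
    using f[of 0] t by simp
  have "((\<lambda>y. S / \<mu>\<^sup>2 * exp (2 * y / \<mu>)) has_integral
      (S / (2 * \<mu>) * exp (2 * t / \<mu>) - S / (2 * \<mu>) * exp (2 * 0 / \<mu>))) {0..t}"
    using t mu
    by (intro fundamental_theorem_of_calculus)
      (auto intro!: derivative_eq_intros simp flip: has_real_derivative_iff_has_vector_derivative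
        simp: power2_eq_square)
  then have int: "((\<lambda>y. S / \<mu>\<^sup>2 * exp (2 * y / \<mu>)) has_integral (S / (2 * \<mu>) * (exp (2 * t / \<mu>) - 1))) {0..t}"
    by (simp add: right_diff_distrib)
  have "norm (integral {0..t} (\<lambda>y. at_time (bessel' \<mu>) (t - y) * at_time f y))
      \<le> integral {0..t} (\<lambda>y. S / \<mu>\<^sup>2 * exp (2 * y / \<mu>))"
  proof (rule integral_norm_bound_integral)
    fix y assume y: "y \<in> {0..t}"
    have "\<bar>at_time (bessel' \<mu>) (t - y)\<bar> * \<bar>at_time f y\<bar> \<le> 1 / \<mu>\<^sup>2 * (S * exp (2 * y / \<mu>))"
      using y by (intro mult_mono f abs_bessel'_le[OF mu]) auto
    then show "norm (at_time (bessel' \<mu>) (t - y) * at_time f y) \<le> S / \<mu>\<^sup>2 * exp (2 * y / \<mu>)"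
      by (simp add: abs_mult)
  qed (use int in \<open>auto intro!: integrable_conv_integrand continuous_on_at_time\<close>)
  also have "\<dots> = S / (2 * \<mu>) * (exp (2 * t / \<mu>) - 1)"
    using int by (rule integral_unique)
  also have "\<dots> \<le> S / (2 * \<mu>) * exp (2 * t / \<mu>)"
    using S mu by (intro mult_left_mono) auto
  finally show ?thesis
    by (simp add: at_time_mult conv_def)
qed

text \<open>The factor 3 / (2 \<mu>) is 1 / \<mu> from the leading part plus 1 / (2 \<mu>) from the
  convolution.\<close>

lemma abs_dtn_le:
  assumes mu: "\<mu> > 0" and f: "\<And>y. 0 \<le> y \<Longrightarrow> y \<le> T \<Longrightarrow> \<bar>at_time f y\<bar> \<le> S * exp (2 * y / \<mu>)"
    and t: "0 \<le> t" "t \<le> T"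
  shows "\<bar>at_time (dtn \<mu> f) t\<bar> \<le> (3 / (2 * \<mu>) * S) * exp (2 * t / \<mu>)"
proof -
  have "\<bar>at_time (dtn \<mu> f) t\<bar> \<le> \<bar>at_time f t / \<mu>\<bar> + \<bar>at_time (bessel' \<mu> * f) t\<bar>"
    unfolding at_dtn by (rule abs_triangle_ineq)
  also have "\<bar>at_time f t / \<mu>\<bar> \<le> S * exp (2 * t / \<mu>) / \<mu>"
    using mu f[of t] t by (simp add: divide_right_mono)
  also have "\<bar>at_time (bessel' \<mu> * f) t\<bar> \<le> S * exp (2 * t / \<mu>) / (2 * \<mu>)"
    by (rule abs_bessel'_mult_le[OF mu]) (use f t in auto)
  finally show ?thesis
    using mu by (simp add: field_simps)
qed

text \<open>
  With \<open>B\<close> the Dirichlet-to-Neumann operator, the assumption says \<open>\<partial>\<^sub>x\<^sup>2 u = B (B u)\<close>, so that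
  \<open>z = \<partial>\<^sub>x u + B u\<close> satisfies \<open>\<partial>\<^sub>x z = B z\<close>. The operator \<open>B\<close> is expanding, and bounded solutions vanish.
\<close>

lemma half_line_dtn:
  fixes u d a :: "real \<Rightarrow> real \<Rightarrow> real"
  assumes mu: "\<mu> > 0"
    and ud: "\<And>x t. 0 < x \<Longrightarrow> 0 \<le> t \<Longrightarrow> t \<le> T \<Longrightarrow> ((\<lambda>y. u y t) has_real_derivative d x t) (at x)"
    and da: "\<And>x t. 0 < x \<Longrightarrow> 0 \<le> t \<Longrightarrow> t \<le> T \<Longrightarrow> ((\<lambda>y. d y t) has_real_derivative a x t) (at x)"
    and cont_d: "continuous_on ({0<..} \<times> {0..T}) (\<lambda>(x, t). d x t)"
    and cont_u: "\<And>x. 0 < x \<Longrightarrow> continuous_on {0..T} (u x)"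
    and cont_a: "\<And>x. 0 < x \<Longrightarrow> continuous_on {0..T} (a x)"
    and eq: "\<And>x t. 0 < x \<Longrightarrow> 0 \<le> t \<Longrightarrow> t \<le> T \<Longrightarrow>
      u x t = \<mu>\<^sup>2 * a x t + integral {0..t} (\<lambda>s. integral {0..s} (a x))"
    and bd: "\<And>x t. 0 < x \<Longrightarrow> 0 \<le> t \<Longrightarrow> t \<le> T \<Longrightarrow> \<bar>u x t\<bar> \<le> C"
    and x: "0 < x" and t: "0 \<le> t" "t \<le> T"
  shows "d x t + u x t / \<mu> + conv (bessel_fun' \<mu>) (u x) t = 0"
proof -
  define A where "A x = causal_upto T (a x)" for x
  \<comment> \<open>Built from A by the integrated equation instead of freezing u after T: the
    relation then holds at all times, as \<open>dtn_dtn\<close> requires, and U still agrees with u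
    on \<open>[0,T]\<close>.\<close>
  define U where "U x = \<mu>\<^sup>2 *\<^sub>R A x + J * J * A x" for x
  define D where "D x = causal_upto T (d x)" for x
  define Z where "Z x = D x + dtn \<mu> (U x)" for x
  have cont_dx: "continuous_on {0..T} (d x)" if "0 < x" for x
    using that by (intro continuous_on_compose2[OF cont_d, of _ "\<lambda>t. (x, t)", simplified] continuous_intros) auto
  have A: "at_time (A x) t = a x t" if "0 < x" "0 \<le> t" "t \<le> T" for x t
    unfolding A_def by (intro at_causal_upto cont_a that)
  have D: "at_time (D x) t = d x t" if "0 < x" "0 \<le> t" "t \<le> T" for x t
    unfolding D_def by (intro at_causal_upto cont_dx that)
  have U: "at_time (U x) t = u x t" if "0 < x" "0 \<le> t" "t \<le> T" for x t
  proof -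
    have "at_time (J * J * A x) t = integral {0..t} (\<lambda>s. integral {0..s} (a x))"
      unfolding mult.assoc at_J_mult using that by (intro integral_cong) (auto simp: A)
    then show ?thesis
      using eq[OF that] by (simp add: U_def A that)
  qed
  have dtn_dtn_U: "dtn \<mu> (dtn \<mu> (U x)) = A x" for x
    by (rule dtn_dtn[OF mu U_def])
  then have dtn_Z: "dtn \<mu> (Z x) = A x + dtn \<mu> (D x)" for x
    by (simp add: Z_def dtn_add)

  have Z_deriv: "((\<lambda>y. at_time (Z y) t) has_real_derivative at_time (dtn \<mu> (Z x)) t) (at x)"
    if x: "0 < x" and t: "0 \<le> t" "t \<le> T" for x t
  proof -
    have n: "continuous_on {0..} (bessel_fun' \<mu>)"
      by (intro continuous_at_imp_continuous_on ballI DERIV_isCont[OF DERIV_bessel_fun'[OF mu]])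
    have "((\<lambda>y. integral (cbox 0 t) (\<lambda>s. bessel_fun' \<mu> (t - s) * u y s)) has_real_derivative
        integral (cbox 0 t) (\<lambda>s. bessel_fun' \<mu> (t - s) * d x s)) (at x within {0<..})"
    proof (rule leibniz_rule_field_derivative)
      fix y s :: real assume y: "y \<in> {0<..}" and s: "s \<in> cbox 0 t"
      show "((\<lambda>y. bessel_fun' \<mu> (t - s) * u y s) has_real_derivative bessel_fun' \<mu> (t - s) * d y s) (at y within {0<..})"
        using y s t by (intro DERIV_cmult has_field_derivative_at_within[OF ud]) auto
    next
      fix y :: real assume y: "y \<in> {0<..}"
      show "(\<lambda>s. bessel_fun' \<mu> (t - s) * u y s) integrable_on cbox 0 t"
        unfolding cbox_interval using y t
        by (intro integrable_continuous_interval continuous_intros continuous_on_compose2[OF n]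
            continuous_on_subset[OF cont_u]) auto
    next
      show "continuous_on ({0<..} \<times> cbox 0 t) (\<lambda>(y, s). bessel_fun' \<mu> (t - s) * d y s)"
        unfolding case_prod_beta using t
        by (intro continuous_intros continuous_on_compose2[OF n]
            continuous_on_subset[OF cont_d[unfolded case_prod_beta]]) auto
    qed (use x in auto)
    then have "((\<lambda>y. conv (bessel_fun' \<mu>) (u y) t) has_real_derivative conv (bessel_fun' \<mu>) (d x) t) (at x)"
      using x by (simp add: conv_def at_within_open[of x "{0<..}"])
    then have "((\<lambda>y. d y t + (u y t / \<mu> + conv (bessel_fun' \<mu>) (u y) t)) has_real_derivative
        a x t + (d x t / \<mu> + conv (bessel_fun' \<mu>) (d x) t)) (at x)"
      by (intro DERIV_add DERIV_cdivide ud da x t)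
    moreover have "a x t + (d x t / \<mu> + conv (bessel_fun' \<mu>) (d x) t) = at_time (dtn \<mu> (Z x)) t"
      unfolding dtn_Z at_time_simps at_dtn at_time_mult
      using x t by (auto simp: A D at_bessel'[OF mu] intro!: conv_cong)
    moreover have "at_time (Z y) t = d y t + (u y t / \<mu> + conv (bessel_fun' \<mu>) (u y) t)" if "0 < y" for y
      unfolding Z_def at_time_simps at_dtn at_time_mult
      using that t by (auto simp: U D at_bessel'[OF mu] intro!: conv_cong)
    ultimately show ?thesis
      by (auto intro: has_field_derivative_transform_within_open[of _ _ _ "{0<..}"] simp: x)
  qed

  define \<beta> where "\<beta> = 3 / (2 * \<mu>)"
  have C: "0 \<le> C"
    using bd[OF x t] by linarith
  have U_le: "\<bar>at_time (U y) s\<bar> \<le> C * exp (2 * s / \<mu>)" if "0 < y" "0 \<le> s" "s \<le> T" for y s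
  proof -
    have "C * 1 \<le> C * exp (2 * s / \<mu>)"
      using that mu C by (intro mult_left_mono) auto
    with bd[OF that] show ?thesis by (simp add: U that)
  qed
  have BU_le: "\<bar>at_time (dtn \<mu> (U y)) s\<bar> \<le> (\<beta> * C) * exp (2 * s / \<mu>)" if "0 < y" "0 \<le> s" "s \<le> T" for y s
    unfolding \<beta>_def by (rule abs_dtn_le[OF mu U_le]) (use that in auto)
  have A_le: "\<bar>at_time (A y) s\<bar> \<le> (\<beta> * (\<beta> * C)) * exp (2 * s / \<mu>)" if "0 < y" "0 \<le> s" "s \<le> T" for y s
    unfolding dtn_dtn_U[symmetric] by (subst \<beta>_def, rule abs_dtn_le[OF mu BU_le]) (use that in auto)
  \<comment> \<open>Bounds on u and on its second derivative bound the first: on an interval of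
    length 1 the mean value theorem provides a point where |d| is at most 2 C, and a second
    application controls the change of d up to that point.\<close>
  have d_le: "\<bar>d y s\<bar> \<le> (2 * C + \<beta> * (\<beta> * C)) * exp (2 * s / \<mu>)" if y: "0 < y" and s: "0 \<le> s" "s \<le> T" for y s
  proof -
    obtain z where z: "y < z" "z < y + 1" "u (y + 1) s - u y s = (y + 1 - y) * d z s"
      using MVT2[of y "y + 1" "\<lambda>y. u y s" "\<lambda>y. d y s"] ud y s by force
    obtain w where w: "y < w" "w < z" "d z s - d y s = (z - y) * a w s"
      using MVT2[of y z "\<lambda>y. d y s" "\<lambda>y. a y s"] da y s z by force
    have "\<bar>d z s\<bar> \<le> 2 * C"
      using bd[of y s] bd[of "y + 1" s] y s z(3) by simp
    moreover have "C * 1 \<le> C * exp (2 * s / \<mu>)"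
      using s mu C by (intro mult_left_mono) auto
    moreover have "\<bar>d z s - d y s\<bar> \<le> 1 * (\<beta> * (\<beta> * C) * exp (2 * s / \<mu>))"
      unfolding w(3) abs_mult using z w A_le[of w s] y s A[of w s]
      by (intro mult_mono) auto
    ultimately show ?thesis
      by (simp add: distrib_right)
  qed
  define S where "S = 2 * C + \<beta> * (\<beta> * C) + \<beta> * C"
  have S: "\<bar>at_time (Z y) s\<bar> \<le> S * exp (2 * s / \<mu>)" if "0 < y" "0 \<le> s" "s \<le> T" for y s
    using abs_triangle_ineq[of "d y s" "at_time (dtn \<mu> (U y)) s"] d_le[OF that] BU_le[OF that]
    by (simp add: Z_def D that S_def distrib_right)

  \<comment> \<open>Along x, z solves z' = z / \<mu> + f with f the convolution part. Boundedness
    gives |z| \<le> \<mu> sup |f|, and with the weight sup |f| is at most 1 / (2 \<mu>) times the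
    previous bound. That bound is used at all larger x and all earlier times, so y and s must vary
    in the induction.\<close>
  have halve: "\<bar>at_time (Z y) s\<bar> \<le> (S / 2 ^ k) * exp (2 * s / \<mu>)" if "0 < y" "0 \<le> s" "s \<le> T" for k y s
    using that
  proof (induction k arbitrary: y s)
    case 0
    then show ?case using S by simp
  next
    case (Suc k)
    define F where "F = (S / 2 ^ k) * exp (2 * s / \<mu>) / (2 * \<mu>)"
    have "\<bar>at_time (Z y) s\<bar> \<le> F / (1 / \<mu>)"
    proof (rule bounded_growth_abs_bound[where z = "\<lambda>w. at_time (Z w) s"
          and f = "\<lambda>w. at_time (bessel' \<mu> * Z w) s"])
      fix w assume w: "y \<le> w"
      show "((\<lambda>y. at_time (Z y) s) has_real_derivative
          1 / \<mu> * at_time (Z w) s + at_time (bessel' \<mu> * Z w) s) (at w)"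
        using Z_deriv[of w s] Suc.prems w by (simp add: at_dtn)
      show "\<bar>at_time (bessel' \<mu> * Z w) s\<bar> \<le> F"
        unfolding F_def by (rule abs_bessel'_mult_le[OF mu]) (use Suc w in auto)
      show "\<bar>at_time (Z w) s\<bar> \<le> S * exp (2 * s / \<mu>)"
        using S Suc.prems w by simp
    qed (use mu in simp)
    then show ?case
      using mu by (simp add: F_def)
  qed
  have "(\<lambda>k. (S * exp (2 * t / \<mu>)) * (1 / 2) ^ k) \<longlonglongrightarrow> (S * exp (2 * t / \<mu>)) * 0"
    by (intro tendsto_mult_left LIMSEQ_power_zero) simp
  then have "\<bar>at_time (Z x) t\<bar> \<le> (S * exp (2 * t / \<mu>)) * 0"
    by (rule LIMSEQ_le_const) (use halve[OF x t] in \<open>auto simp: power_one_over field_simps\<close>)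
  then have "at_time (Z x) t = 0" by simp
  moreover have "conv (at_time (bessel' \<mu>)) (at_time (U x)) t = conv (bessel_fun' \<mu>) (u x) t"
    using x t by (intro conv_cong) (auto simp: U at_bessel'[OF mu])
  ultimately show ?thesis
    using x t by (simp add: Z_def at_dtn at_time_mult U D)
qed

section \<open>Fields on strips\<close>

lemma Dx_has_derivative:
  assumes "x_C1 X T f" "x \<in> X" "0 \<le> t" "t \<le> T"
  shows "((\<lambda>y. f y t) has_real_derivative Dx X f x t) (at x within X)"
proof -
  have "(\<lambda>y. f y t) differentiable (at x within X)"
    using assms by (simp add: x_C1_def)
  then show ?thesis
    unfolding Dx_def has_real_derivative_iff_has_vector_derivative
    by (rule vector_derivative_works[THEN iffD1])
qed

lemma Dt_has_derivative:
  assumes "t_C1 X T f" "x \<in> X" "0 \<le> t" "t \<le> T"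
  shows "((\<lambda>s. f x s) has_real_derivative Dt T f x t) (at t within {0..T})"
proof -
  have "(\<lambda>s. f x s) differentiable (at t within {0..T})"
    using assms by (simp add: t_C1_def)
  then show ?thesis
    unfolding Dt_def has_real_derivative_iff_has_vector_derivative
    by (rule vector_derivative_works[THEN iffD1])
qed

lemma Dt_has_derivative_interior:
  assumes "t_C1 X T f" "x \<in> X" "0 < t" "t < T"
  shows "(f x has_real_derivative Dt T f x t) (at t)"
  using Dt_has_derivative[OF assms(1,2), of t] assms(3,4) at_within_Icc_at[OF assms(3,4)] by simp

lemma Dx_has_derivative_interior:
  assumes "x_C1 X T f" "x \<in> interior X" "0 \<le> t" "t \<le> T"
  shows "((\<lambda>y. f y t) has_real_derivative Dx X f x t) (at x)"
  using Dx_has_derivative[OF assms(1) subsetD[OF interior_subset assms(2)] assms(3,4)]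
  unfolding at_within_interior[OF assms(2)] .

lemma continuous_on_field_t:
  assumes "continuous_on (X \<times> S) (\<lambda>(x, t). f x t)" "x \<in> X" "R \<subseteq> S"
  shows "continuous_on R (f x)"
  using assms by (intro continuous_on_compose2[OF assms(1), of R "\<lambda>t. (x, t)", simplified] continuous_intros) auto

lemma continuous_on_field_x:
  assumes "continuous_on (X \<times> S) (\<lambda>(x, t). f x t)" "t \<in> S" "Y \<subseteq> X"
  shows "continuous_on Y (\<lambda>x. f x t)"
  using assms by (intro continuous_on_compose2[OF assms(1), of Y "\<lambda>x. (x, t)", simplified] continuous_intros) auto

lemma C1_stripD:
  assumes "C1_strip X T f"
  shows "x_C1 X T f" "t_C1 X T f"
    "continuous_on (X \<times> {0..T}) (\<lambda>(x, t). f x t)"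
    "continuous_on (X \<times> {0..T}) (\<lambda>(x, t). Dx X f x t)"
    "continuous_on (X \<times> {0..T}) (\<lambda>(x, t). Dt T f x t)"
  using assms by (auto simp: C1_strip_def x_C1_def t_C1_def)

lemma field_eq_integral_Dt:
  assumes f: "C1_strip X T f" and x: "x \<in> X" and t: "0 \<le> t" "t \<le> T"
    and g: "\<And>s. 0 < s \<Longrightarrow> s < T \<Longrightarrow> Dt T f x s = g s"
  shows "f x t = f x 0 + integral {0..t} g"
proof -
  have "(g has_integral f x t - f x 0) {0..t}"
  proof (rule fundamental_theorem_of_calculus_interior)
    show "continuous_on {0..t} (f x)"
      using t by (intro continuous_on_field_t[OF C1_stripD(3)[OF f] x]) auto
    fix s assume "s \<in> {0<..<t}"
    then show "(f x has_vector_derivative g s) (at s)"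
      using Dt_has_derivative_interior[OF C1_stripD(2)[OF f] x, of s] t g[of s]
      by (simp add: has_real_derivative_iff_has_vector_derivative)
  qed (use t in simp)
  then show ?thesis
    by (simp add: integral_unique)
qed

section \<open>The Boussinesq equations integrated in time\<close>

lemma leibniz_integral_field:
  fixes f g :: field
  assumes deriv: "\<And>x t. 0 < x \<Longrightarrow> 0 \<le> t \<Longrightarrow> t \<le> T \<Longrightarrow> ((\<lambda>y. f y t) has_real_derivative g x t) (at x)"
    and f: "continuous_on ({0<..} \<times> {0..T}) (\<lambda>(x, t). f x t)"
    and g: "continuous_on ({0<..} \<times> {0..T}) (\<lambda>(x, t). g x t)"
    and x: "0 < x" and t: "0 \<le> t" "t \<le> T"
  shows "((\<lambda>y. integral {0..t} (f y)) has_real_derivative integral {0..t} (g x)) (at x)"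
proof -
  have "((\<lambda>y. integral (cbox 0 t) (f y)) has_real_derivative integral (cbox 0 t) (g x)) (at x within {0<..})"
  proof (rule leibniz_rule_field_derivative)
    fix y s :: real assume y: "y \<in> {0<..}" and s: "s \<in> cbox 0 t"
    then show "((\<lambda>y. f y s) has_real_derivative g y s) (at y within {0<..})"
      using t by (intro has_field_derivative_at_within[OF deriv]) auto
  next
    fix y :: real assume "y \<in> {0<..}"
    then show "f y integrable_on cbox 0 t"
      using t unfolding cbox_interval
      by (intro integrable_continuous_interval continuous_on_field_t[OF f]) auto
  next
    show "continuous_on ({0<..} \<times> cbox 0 t) (\<lambda>(x, t). g x t)"
      using t by (intro continuous_on_subset[OF g]) auto
  qed (use x in auto)
  then show ?thesis
    using x by (simp add: at_within_open[of x "{0<..}"])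
qed

text \<open>Only the time derivative of u comes with two x-derivatives. Since u vanishes initially
  it is the time integral of v, so differentiation under the integral supplies its x-derivatives d
  and a for x > 0, where \<open>half_line_dtn\<close> applies.\<close>

lemma boussinesq_boundary:
  assumes mu: "\<mu> > 0" and B: "B_classical \<mu> {0..} T \<eta> u"
    and bd: "\<And>x t. 0 < x \<Longrightarrow> 0 < t \<Longrightarrow> t < T \<Longrightarrow> \<bar>u x t\<bar> \<le> C"
    and init: "\<And>x. 0 < x \<Longrightarrow> \<eta> x 0 = 0 \<and> u x 0 = 0"
    and T: "0 < T" and t: "0 \<le> t" "t \<le> T"
  shows "Dx {0..} u 0 t + u 0 t / \<mu> + conv (bessel_fun' \<mu>) (u 0) t = 0"
proof -
  define v where "v = Dt T u"
  define vx where "vx = Dx {0..} v"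
  define vxx where "vxx = Dx {0..} vx"
  define d where "d x t = integral {0..t} (vx x)" for x t
  define a where "a x t = integral {0..t} (vxx x)" for x t
  have C1: "C1_strip {0..} T \<eta>" "C1_strip {0..} T u"
    and v: "x_C1 {0..} T v" and vx: "x_C1 {0..} T vx"
    and pde: "\<And>x t. 0 < x \<Longrightarrow> 0 < t \<Longrightarrow> t < T \<Longrightarrow> Dt T \<eta> x t = - Dx {0..} u x t"
      "\<And>x t. 0 < x \<Longrightarrow> 0 < t \<Longrightarrow> t < T \<Longrightarrow> v x t = \<mu>\<^sup>2 * vxx x t - Dx {0..} \<eta> x t"
    using B unfolding B_classical_def L_B_def v_def vx_def vxx_def
    by (force simp: eq_neg_iff_add_eq_0 algebra_simps)+
  have sub: "continuous_on ({0<..} \<times> {0..T}) f" if "continuous_on ({0..} \<times> {0..T}) f" for f :: "real \<times> real \<Rightarrow> real"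
    by (rule continuous_on_subset[OF that]) auto
  have cont_v: "continuous_on ({0<..} \<times> {0..T}) (\<lambda>(x, t). v x t)"
    and cont_vx: "continuous_on ({0<..} \<times> {0..T}) (\<lambda>(x, t). vx x t)"
    and cont_vxx: "continuous_on ({0<..} \<times> {0..T}) (\<lambda>(x, t). vxx x t)"
    using C1_stripD(5)[OF C1(2)] v vx
    by (intro sub; simp add: x_C1_def v_def vx_def vxx_def)+
  have u_eq: "u x t = integral {0..t} (v x)" if "0 < x" "0 \<le> t" "t \<le> T" for x t
    using field_eq_integral_Dt[OF C1(2), of x t "v x"] that init[of x] by (simp add: v_def)
  have u_d: "((\<lambda>y. u y t) has_real_derivative d x t) (at x)" if x: "0 < x" and t: "0 \<le> t" "t \<le> T" for x t
  proof -
    have "((\<lambda>y. integral {0..t} (v y)) has_real_derivative d x t) (at x)"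
      unfolding d_def using Dx_has_derivative_interior[OF v]
      by (intro leibniz_integral_field[OF _ cont_v cont_vx x t]) (auto simp: vx_def)
    then show ?thesis
      by (rule has_field_derivative_transform_within_open[of _ _ _ "{0<..}"]) (use x t u_eq in auto)
  qed
  have d_a: "((\<lambda>y. d y t) has_real_derivative a x t) (at x)" if x: "0 < x" and t: "0 \<le> t" "t \<le> T" for x t
    unfolding d_def a_def using Dx_has_derivative_interior[OF vx]
    by (intro leibniz_integral_field[OF _ cont_vx cont_vxx x t]) (auto simp: vxx_def)
  have Dx_u: "Dx {0..} u x t = d x t" if "0 < x" "0 \<le> t" "t \<le> T" for x t
    using that by (intro DERIV_unique[OF Dx_has_derivative_interior[OF C1_stripD(1)[OF C1(2)]] u_d]) auto
  have cont_d: "continuous_on ({0<..} \<times> {0..T}) (\<lambda>(x, t). d x t)"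
    and cont_a: "continuous_on ({0<..} \<times> {0..T}) (\<lambda>(x, t). a x t)"
    unfolding d_def a_def by (intro continuous_on_integral_upper cont_vx cont_vxx)+
  have eta: "\<eta> x t = - integral {0..t} (d x)" if "0 < x" "0 \<le> t" "t \<le> T" for x t
    using field_eq_integral_Dt[OF C1(1), of x t "\<lambda>s. - d x s"] that init[of x] by (simp add: pde Dx_u)
  have Dx_eta: "Dx {0..} \<eta> x t = - integral {0..t} (a x)" if x: "0 < x" and t: "0 \<le> t" "t \<le> T" for x t
  proof -
    have "((\<lambda>y. - integral {0..t} (d y)) has_real_derivative - integral {0..t} (a x)) (at x)"
      by (intro DERIV_minus leibniz_integral_field[OF d_a cont_d cont_a x t])
    then have "((\<lambda>y. \<eta> y t) has_real_derivative - integral {0..t} (a x)) (at x)"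
      by (rule has_field_derivative_transform_within_open[of _ _ _ "{0<..}"]) (use x t eta in auto)
    then show ?thesis
      using x t by (intro DERIV_unique[OF Dx_has_derivative_interior[OF C1_stripD(1)[OF C1(1)]]]) auto
  qed
  have interior: "d x t + u x t / \<mu> + conv (bessel_fun' \<mu>) (u x) t = 0" if x: "0 < x" for x
  proof (rule half_line_dtn[where T = T and C = C and a = a, OF mu u_d d_a cont_d])
    show "continuous_on {0..T} (u x)" if "0 < x" for x
      using that by (intro continuous_on_field_t[OF C1_stripD(3)[OF C1(2)]]) auto
    show cont_a': "continuous_on {0..T} (a x)" if "0 < x" for x
      using that by (intro continuous_on_field_t[OF cont_a]) auto
    show "u x t = \<mu>\<^sup>2 * a x t + integral {0..t} (\<lambda>s. integral {0..s} (a x))"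
      if x: "0 < x" and t: "0 \<le> t" "t \<le> T" for x t
    proof -
      \<comment> \<open>The equations hold strictly between 0 and T, and t may be T, so the
        integrands are compared on the open interval.\<close>
      have "u x t = integral {0<..<t} (v x)"
        by (simp add: u_eq x t integral_open_interval_real)
      also have "\<dots> = integral {0<..<t} (\<lambda>s. \<mu>\<^sup>2 * vxx x s + integral {0..s} (a x))"
        using x t by (intro integral_cong) (auto simp: pde Dx_eta)
      also have "\<dots> = integral {0..t} (\<lambda>s. \<mu>\<^sup>2 * vxx x s) + integral {0..t} (\<lambda>s. integral {0..s} (a x))"
        unfolding integral_open_interval_real[symmetric]
        using x t
        by (intro integral_add integrable_continuous_interval continuous_intros
            continuous_on_field_t[OF cont_vxx]
            continuous_on_field_t[OF continuous_on_integral_upper[OF cont_a]]) auto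
      finally show ?thesis
        by (simp add: a_def)
    qed
    show "\<bar>u x t\<bar> \<le> C" if x: "0 < x" and t: "0 \<le> t" "t \<le> T" for x t
    proof -
      have "continuous_on (closure {0<..<T}) (\<lambda>t. \<bar>u x t\<bar>)"
        using x T by (intro continuous_intros continuous_on_field_t[OF C1_stripD(3)[OF C1(2)]]) auto
      from continuous_le_on_closure[OF this, of t C] show ?thesis
        using bd x t T by simp
    qed
  qed (use x t in auto)
  \<comment> \<open>The relation has been obtained for x > 0; continuity of w up to the boundary
    carries it to the interface.\<close>
  define w where "w x = Dx {0..} u x t + u x t / \<mu> + conv (bessel_fun' \<mu>) (u x) t" for x
  have n: "continuous_on {0..} (bessel_fun' \<mu>)"
    by (intro continuous_at_imp_continuous_on ballI DERIV_isCont[OF DERIV_bessel_fun'[OF mu]])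
  have "continuous_on {0..} (\<lambda>x. integral (cbox 0 t) (\<lambda>s. bessel_fun' \<mu> (t - s) * u x s))"
  proof (rule integral_continuous_on_param)
    show "continuous_on ({0..} \<times> cbox 0 t) (\<lambda>(x, s). bessel_fun' \<mu> (t - s) * u x s)"
      unfolding case_prod_beta using t
      by (intro continuous_intros continuous_on_compose2[OF n]
          continuous_on_subset[OF C1_stripD(3)[OF C1(2), unfolded case_prod_beta]]) auto
  qed
  then have "continuous_on {0..} w"
    unfolding w_def conv_def using t mu
    by (intro continuous_intros continuous_on_field_x[OF C1_stripD(3)[OF C1(2)]]
        continuous_on_field_x[OF C1_stripD(4)[OF C1(2)]]) auto
  then have "w 0 = 0"
    using continuous_constant_on_closure[of "{0<..}" w 0 0] interior t
    by (auto simp: w_def Dx_u)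
  then show ?thesis
    by (simp add: w_def)
qed

section \<open>Characteristics of the Saint-Venant equations\<close>

text \<open>Partial derivatives alone do not permit the chain rule; continuity of the time
  derivative upgrades them to joint differentiability on the open strip.\<close>

lemma field_along_line_has_derivative:
  assumes f: "C1_strip X T f" and x: "c + \<sigma> * t \<in> interior X" and t: "0 < t" "t < T"
  shows "((\<lambda>r. f (c + \<sigma> * r) r) has_real_derivative
    Dx X f (c + \<sigma> * t) t * \<sigma> + Dt T f (c + \<sigma> * t) t) (at t)"
proof -
  define y where "y = c + \<sigma> * t"
  have y: "y \<in> interior X" using x by (simp add: y_def)
  have op: "open (interior X \<times> {0<..<T})"
    by (intro open_Times) auto
  have "((\<lambda>(x, t). f x t) has_derivative (\<lambda>(tx, ty). Dx X f y t * tx + blinfun_mult_right (Dt T f y t) ty))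
      (at (y, t) within interior X \<times> {0<..<T})"
  proof (rule has_derivative_partialsI[where fy = "\<lambda>x t. blinfun_mult_right (Dt T f x t)"])
    show "((\<lambda>x. f x t) has_derivative (\<lambda>tx. Dx X f y t * tx)) (at y within interior X)"
      using has_field_derivative_at_within[OF Dx_has_derivative_interior[OF C1_stripD(1)[OF f] y]] t
      by (simp add: has_field_derivative_def)
    fix x s :: real assume "x \<in> interior X" "s \<in> {0<..<T}"
    then show "(f x has_derivative blinfun_apply (blinfun_mult_right (Dt T f x s))) (at s within {0<..<T})"
      using has_field_derivative_at_within[OF Dt_has_derivative_interior[OF C1_stripD(2)[OF f] subsetD[OF interior_subset]]]
      by (simp add: has_field_derivative_def)
  next
    have "continuous_on (interior X \<times> {0<..<T}) (\<lambda>p. Dt T f (fst p) (snd p))"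
      using C1_stripD(5)[OF f, unfolded case_prod_beta]
      by (rule continuous_on_subset) (auto intro: subsetD[OF interior_subset])
    then have "continuous_on (interior X \<times> {0<..<T}) (\<lambda>p. blinfun_mult_right (Dt T f (fst p) (snd p)))"
      by (rule bounded_linear.continuous_on[OF bounded_linear_blinfun_mult_right])
    then show "continuous (at (y, t) within interior X \<times> {0<..<T}) (\<lambda>(x, t). blinfun_mult_right (Dt T f x t))"
      unfolding case_prod_beta continuous_on_eq_continuous_within
      by (rule bspec) (use y t in simp)
  qed (use t in auto)
  then have "((\<lambda>(x, t). f x t) has_derivative (\<lambda>(tx, ty). Dx X f y t * tx + Dt T f y t * ty)) (at (y, t))"
    using at_within_open[OF _ op, of "(y, t)"] y t by simp
  moreover have "((\<lambda>r. (c + \<sigma> * r, r)) has_derivative (\<lambda>h. (\<sigma> * h, h))) (at t)"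
    by (intro has_derivative_Pair has_derivative_add_const has_derivative_mult_right has_derivative_ident
        has_derivative_add[OF has_derivative_const, simplified])
  ultimately have "((\<lambda>(x, t). f x t) \<circ> (\<lambda>r. (c + \<sigma> * r, r)) has_derivative
      (\<lambda>(tx, ty). Dx X f y t * tx + Dt T f y t * ty) \<circ> (\<lambda>h. (\<sigma> * h, h))) (at t)"
    unfolding y_def by (intro diff_chain_at)
  moreover have "(\<lambda>(tx, ty). Dx X f y t * tx + Dt T f y t * ty) \<circ> (\<lambda>h. (\<sigma> * h, h)) =
      (*) (Dx X f y t * \<sigma> + Dt T f y t)"
    by (simp add: fun_eq_iff distrib_right mult.assoc)
  ultimately show ?thesis
    unfolding has_field_derivative_def y_def[symmetric] by (simp add: comp_def)
qed

lemma continuous_on_field_along_line: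
  fixes f :: field and R :: "real set"
  assumes "continuous_on (X \<times> {0..T}) (\<lambda>(x, t). f x t)" "R \<subseteq> {0..T}" "\<And>r. r \<in> R \<Longrightarrow> c + \<sigma> * r \<in> X"
  shows "continuous_on R (\<lambda>r. f (c + \<sigma> * r) r)"
proof -
  have "continuous_on R (\<lambda>r. (c + \<sigma> * r, r))"
    by (intro continuous_intros)
  then have "continuous_on R (\<lambda>r. case (c + \<sigma> * r, r) of (x, t) \<Rightarrow> f x t)"
    by (rule continuous_on_compose2[OF assms(1)]) (use assms(2,3) in auto)
  then show ?thesis by simp
qed

text \<open>Here \<sigma> is 1 or -1, one value for each family of characteristics: by the equations
  the derivative along the line is (\<sigma>^2 - 1) times the x-derivative of u. Endpoints may lie
  on the boundary of X, so that a characteristic may start or end at the interface.\<close>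

lemma SV_characteristic:
  assumes W: "SV_classical X T \<eta> u" and \<sigma>: "\<sigma> * \<sigma> = 1"
    and t: "0 \<le> s" "s \<le> t" "t \<le> T"
    and X: "\<And>r. s \<le> r \<Longrightarrow> r \<le> t \<Longrightarrow> x + \<sigma> * (r - t) \<in> X"
    and int: "\<And>r. s < r \<Longrightarrow> r < t \<Longrightarrow> x + \<sigma> * (r - t) \<in> interior X"
  shows "\<eta> x t + \<sigma> * u x t = \<eta> (x + \<sigma> * (s - t)) s + \<sigma> * u (x + \<sigma> * (s - t)) s"
proof (cases "s = t")
  case False
  then have st: "s < t" using t by simp
  define c where "c = x - \<sigma> * t"
  have c: "x + \<sigma> * (r - t) = c + \<sigma> * r" for r
    by (simp add: c_def algebra_simps)
  note X = X[unfolded c] and int = int[unfolded c]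
  define \<phi> where "\<phi> r = \<eta> (c + \<sigma> * r) r + \<sigma> * u (c + \<sigma> * r) r" for r
  have C1: "C1_strip X T \<eta>" "C1_strip X T u"
    and pde: "\<And>x t. x \<in> interior X \<Longrightarrow> 0 < t \<Longrightarrow> t < T \<Longrightarrow>
      Dt T \<eta> x t = - Dx X u x t \<and> Dt T u x t = - Dx X \<eta> x t"
    using W by (auto simp: SV_classical_def L_SV_def eq_neg_iff_add_eq_0)
  have "\<phi> t = \<phi> s"
  proof (rule DERIV_isconst_end[OF st])
    show "continuous_on {s..t} \<phi>"
      unfolding \<phi>_def using t X
      by (intro continuous_intros continuous_on_field_along_line[OF C1_stripD(3)[OF C1(1)]]
          continuous_on_field_along_line[OF C1_stripD(3)[OF C1(2)]]) auto
    fix r assume r: "s < r" "r < t"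
    let ?y = "c + \<sigma> * r"
    have r': "0 < r" "r < T" and y: "?y \<in> interior X"
      using r t int by auto
    have "(\<phi> has_real_derivative (Dx X \<eta> ?y r * \<sigma> + Dt T \<eta> ?y r) + \<sigma> * (Dx X u ?y r * \<sigma> + Dt T u ?y r)) (at r)"
      unfolding \<phi>_def
      by (intro DERIV_add DERIV_cmult field_along_line_has_derivative C1 y r')
    also have "(Dx X \<eta> ?y r * \<sigma> + Dt T \<eta> ?y r) + \<sigma> * (Dx X u ?y r * \<sigma> + Dt T u ?y r) =
        (\<sigma> * \<sigma> - 1) * Dx X u ?y r"
      using pde[OF y r'] by (simp add: algebra_simps)
    finally show "DERIV \<phi> r :> 0"
      by (simp add: \<sigma>)
  qed
  then show ?thesis
    unfolding c by (simp add: \<phi>_def c_def)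
qed simp

lemma SV_cauchy_characteristics:
  assumes "SV_cauchy T (\<eta>0, u0) (\<eta>, u)" "0 \<le> t" "t \<le> T"
  shows "\<eta> x t + u x t = \<eta>0 (x - t) + u0 (x - t)" "\<eta> x t - u x t = \<eta>0 (x + t) - u0 (x + t)"
  using assms SV_characteristic[of UNIV T \<eta> u 1 0 t x] SV_characteristic[of UNIV T \<eta> u "-1" 0 t x]
  by (simp_all add: SV_cauchy_def)

section \<open>The reflected wave\<close>

text \<open>The action of r = 1 - (1 - r) with its Dirac mass split off; the value 0 for x \<le> 0
  matches the representative that \<open>is_inv_laplace\<close> selects.\<close>

definition reflected_wave :: "real \<Rightarrow> (real \<Rightarrow> real) \<Rightarrow> real \<Rightarrow> real" where
  "reflected_wave \<mu> g x = (if x \<le> 0 then 0 else g x - conv (at_time (refl_kernel \<mu>)) g x)"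

text \<open>Both solutions carry the same right-going invariant from the initial line, so their
  difference satisfies \<eta>' = - u' and depends on x + t only. The function p is half the
  right-going invariant arriving at the interface, as a function of time.\<close>

lemma hybrid_minus_cauchy:
  assumes mu: "\<mu> > 0" and T: "T > 0"
    and supp: "\<And>x. 0 \<le> x \<Longrightarrow> \<eta>0 x = 0 \<and> u0 x = 0"
    and hybrid: "hybrid_SV_B \<mu> T (\<eta>0, u0) (\<eta>m, um) (\<eta>p, up)"
    and cauchy: "SV_cauchy T (\<eta>0, u0) (\<eta>c, uc)"
    and x: "x \<le> 0" and t: "0 \<le> t" "t \<le> T"
  defines "p \<equiv> \<lambda>y. (\<eta>0 (- y) + u0 (- y)) / 2"
  shows "\<eta>m x t - \<eta>c x t = - reflected_wave \<mu> p (x + t)"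
    and "um x t - uc x t = reflected_wave \<mu> p (x + t)"
proof -
  have Wm: "SV_classical {..0} T \<eta>m um" and Wp: "B_classical \<mu> {0..} T \<eta>p up"
    and init_p: "\<And>x. x > 0 \<Longrightarrow> \<eta>p x 0 = \<eta>0 x \<and> up x 0 = u0 x"
    and init_m: "\<And>x. x < 0 \<Longrightarrow> \<eta>m x 0 = \<eta>0 x \<and> um x 0 = u0 x"
    and interface: "\<And>t. 0 < t \<Longrightarrow> t < T \<Longrightarrow> um 0 t = up 0 t \<and> Dx {..0} um 0 t = Dx {0..} up 0 t"
    using hybrid by (auto simp: hybrid_SV_B_def Let_def)
  have "\<exists>C. \<forall>x>0. \<forall>t\<in>{0<..<T}. \<bar>up x t\<bar> \<le> C"
    using hybrid by (simp add: hybrid_SV_B_def Let_def)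
  then obtain C where C: "\<And>x t. 0 < x \<Longrightarrow> 0 < t \<Longrightarrow> t < T \<Longrightarrow> \<bar>up x t\<bar> \<le> C"
    by (metis greaterThanLessThan_iff)
  have C1: "C1_strip {..0} T \<eta>m" "C1_strip {..0} T um" "C1_strip {0..} T up"
    "C1_strip UNIV T \<eta>c" "C1_strip UNIV T uc"
    using Wm Wp cauchy by (auto simp: SV_classical_def B_classical_def SV_cauchy_def)
  have init_c: "\<eta>c x 0 = \<eta>0 x" "uc x 0 = u0 x" for x
    using cauchy by (auto simp: SV_cauchy_def)
  have init0: "\<eta>m x 0 = \<eta>0 x \<and> um x 0 = u0 x" if "x \<le> 0" for x
  proof -
    have "continuous_on (closure {..<0}) (\<lambda>x. \<eta>m x 0 - \<eta>c x 0)"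
      using T by (auto intro!: continuous_intros continuous_on_field_x[OF C1_stripD(3)[OF C1(1)]]
          continuous_on_field_x[OF C1_stripD(3)[OF C1(4)]])
    from continuous_constant_on_closure[OF this, of 0 x] have "\<eta>m x 0 = \<eta>0 x"
      using that init_m by (simp add: init_c)
    moreover have "continuous_on (closure {..<0}) (\<lambda>x. um x 0 - uc x 0)"
      using T by (auto intro!: continuous_intros continuous_on_field_x[OF C1_stripD(3)[OF C1(2)]]
          continuous_on_field_x[OF C1_stripD(3)[OF C1(5)]])
    from continuous_constant_on_closure[OF this, of 0 x] have "um x 0 = u0 x"
      using that init_m by (simp add: init_c)
    ultimately show ?thesis ..
  qed
  have right_going: "\<eta>m x t + um x t = \<eta>0 (x - t) + u0 (x - t)" if "x \<le> 0" "0 \<le> t" "t \<le> T" for x t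
    using SV_characteristic[OF Wm, of 1 0 t x] that init0[of "x - t"] by simp
  have left_going: "\<eta>m x t - um x t = \<eta>m (x + t - s) s - um (x + t - s) s"
    if "x + t - s \<le> 0" "0 \<le> s" "s \<le> t" "t \<le> T" for x t s
    using SV_characteristic[OF Wm, of "-1" s t x] that by (simp add: algebra_simps)
  note cauchy_sol = SV_cauchy_characteristics[OF cauchy]

  \<comment> \<open>By continuity the first equation holds on the interface itself. It trades the
    x-derivative of u for a time derivative of \<eta>, so the slope condition becomes a relation
    between time traces.\<close>
  have slope: "Dt T \<eta>m 0 s = - Dx {..0} um 0 s" if s: "0 < s" "s < T" for s
  proof -
    have "continuous_on (closure {..<0}) (\<lambda>x. Dt T \<eta>m x s + Dx {..0} um x s)"
      using s by (auto intro!: continuous_intros continuous_on_field_x[OF C1_stripD(5)[OF C1(1)]]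
          continuous_on_field_x[OF C1_stripD(4)[OF C1(2)]])
    from continuous_constant_on_closure[OF this, of 0 0] show ?thesis
      using s Wm by (auto simp: SV_classical_def L_SV_def eq_neg_iff_add_eq_0)
  qed
  have trace: "um 0 s = up 0 s" if "0 \<le> s" "s \<le> T" for s
  proof -
    have "continuous_on (closure {0<..<T}) (\<lambda>s. um 0 s - up 0 s)"
      using T by (auto intro!: continuous_intros continuous_on_field_t[OF C1_stripD(3)[OF C1(2)]]
          continuous_on_field_t[OF C1_stripD(3)[OF C1(3)]])
    from continuous_constant_on_closure[OF this, of 0 s] show ?thesis
      using that T interface by auto
  qed

  define b where "b = causal_upto T (um 0)"
  have b: "at_time b s = um 0 s" if "0 \<le> s" "s \<le> T" for s
    unfolding b_def
    by (rule at_causal_upto[OF continuous_on_field_t[OF C1_stripD(3)[OF C1(2)]]]) (use that in auto)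
  \<comment> \<open>Slope, interface and Boussinesq relation combine to: the time derivative of
    \<eta> at the interface is \<open>dtn\<close> of the trace b. Integrating from 0, where \<eta>
    vanishes, gives \<eta> = \<open>bessel\<close> convolved with b, and \<eta> + u = 2 p
    there.\<close>
  have b_p: "at_time (bessel \<mu> * b) s = 2 * p s - um 0 s" if s: "0 \<le> s" "s \<le> T" for s
  proof -
    have "Dt T \<eta>m 0 r = at_time (dtn \<mu> b) r" if r: "0 < r" "r < T" for r
    proof -
      have "conv (bessel_fun' \<mu>) (up 0) r = conv (at_time (bessel' \<mu>)) (at_time b) r"
        using r by (intro conv_cong) (auto simp: at_bessel'[OF mu] b trace)
      then show ?thesis
        using boussinesq_boundary[OF mu Wp C _ T, of r] r slope[of r] interface[of r] init_p supp
        by (simp add: at_dtn at_time_mult b)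
    qed
    then have "\<eta>m 0 s = \<eta>m 0 0 + integral {0..s} (at_time (dtn \<mu> b))"
      by (intro field_eq_integral_Dt[OF C1(1)]) (use s in auto)
    also have "\<dots> = at_time (bessel \<mu> * b) s"
      using init0[of 0] supp[of 0] by (simp add: J_mult_dtn[OF mu] flip: at_J_mult)
    finally show ?thesis
      using right_going[of 0 s] s by (simp add: p_def add_divide_distrib)
  qed
  have um0: "um 0 s = 2 * p s - conv (at_time (refl_kernel \<mu>)) p s" if s: "0 \<le> s" "s \<le> T" for s
  proof -
    \<comment> \<open>A causal function that agrees with p up to time s; being written in terms of
      b, it reduces the solution of the Volterra equation to the resolvent identity in the
      ring.\<close>
    define q where "q = (1 / 2) *\<^sub>R (b + bessel \<mu> * b)"
    have q: "at_time q r = p r" if "0 \<le> r" "r \<le> s" for r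
      using that s by (simp add: q_def b b_p)
    have "refl_kernel \<mu> * q = (1 / 2) *\<^sub>R ((refl_kernel \<mu> + bessel \<mu> * refl_kernel \<mu>) * b)"
      by (simp add: q_def algebra_simps)
    also have "\<dots> = bessel \<mu> * b"
      unfolding refl_kernel_eq[OF mu] by simp
    finally have "at_time (refl_kernel \<mu> * q) s = 2 * p s - um 0 s"
      using b_p s by simp
    moreover have "at_time (refl_kernel \<mu> * q) s = conv (at_time (refl_kernel \<mu>)) p s"
      unfolding at_time_mult by (rule conv_cong) (auto simp: q)
    ultimately show ?thesis by simp
  qed

  have sum: "\<eta>m x t + um x t = \<eta>c x t + uc x t"
    using right_going x t cauchy_sol by simp
  \<comment> \<open>The left-going characteristic through (x, t) either comes from the initial line,
    and then carries no reflection, or it left the interface at time x + t. In the second case the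
    left-going invariant of the Cauchy solution is zero by the support of the data.\<close>
  have "um x t - uc x t = reflected_wave \<mu> p (x + t)"
  proof (cases "x + t \<le> 0")
    case True
    then show ?thesis
      using left_going[of x t 0] t init0[of "x + t"] sum cauchy_sol[of t x]
      by (simp add: reflected_wave_def)
  next
    case False
    then have "\<eta>m x t - um x t = \<eta>m 0 (x + t) - um 0 (x + t)"
      using left_going[of x t "x + t"] x t by simp
    also have "\<eta>m 0 (x + t) = 2 * p (x + t) - um 0 (x + t)"
      using right_going[of 0 "x + t"] x t False by (simp add: p_def add_divide_distrib)
    finally show ?thesis
      using sum cauchy_sol(2)[of t x] supp[of "x + t"] um0[of "x + t"] x t False
      by (simp add: reflected_wave_def)
  qed
  with sum show "\<eta>m x t - \<eta>c x t = - reflected_wave \<mu> p (x + t)"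
    and "um x t - uc x t = reflected_wave \<mu> p (x + t)"
    by auto
qed

section \<open>The Laplace transform of causal functions\<close>

definition laplace_kernel :: "complex \<Rightarrow> (real \<Rightarrow> real) \<Rightarrow> real \<Rightarrow> complex" where
  "laplace_kernel s f x = indicator {0<..} x *\<^sub>R (exp (- s * complex_of_real x) * complex_of_real (f x))"

lemma laplace_integrable_iff: "laplace_integrable f s \<longleftrightarrow> integrable lborel (laplace_kernel s f)"
  by (simp add: laplace_integrable_def set_integrable_def laplace_kernel_def[abs_def])

lemma laplace_eq: "laplace f s = integral\<^sup>L lborel (laplace_kernel s f)"
  by (simp add: laplace_def set_lebesgue_integral_def laplace_kernel_def[abs_def])

lemma laplace_kernel_cong:
  assumes "\<And>x. 0 < x \<Longrightarrow> f x = g x"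
  shows "laplace_kernel s f = laplace_kernel s g"
  using assms by (auto simp: laplace_kernel_def fun_eq_iff indicator_def)

lemma norm_laplace_kernel: "norm (laplace_kernel s f x) = indicator {0<..} x * (exp (- Re s * x) * \<bar>f x\<bar>)"
  by (simp add: laplace_kernel_def norm_mult abs_mult)

lemma laplace_kernel_shift: "laplace_kernel s' f x = exp ((s - s') * complex_of_real x) * laplace_kernel s f x"
  by (simp add: laplace_kernel_def algebra_simps flip: exp_add)

lemma laplace_integrable_mono:
  assumes "laplace_integrable f s" "Re s \<le> Re s'"
  shows "laplace_integrable f s'"
  unfolding laplace_integrable_iff
proof (rule Bochner_Integration.integrable_bound)
  show int: "integrable lborel (laplace_kernel s f)"
    using assms(1) by (simp add: laplace_integrable_iff)
  have "(\<lambda>x. exp ((s - s') * complex_of_real x) * laplace_kernel s f x) \<in> borel_measurable lborel"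
    using borel_measurable_integrable[OF int] by (intro borel_measurable_times) auto
  then show "laplace_kernel s' f \<in> borel_measurable lborel"
    by (simp add: laplace_kernel_shift[of s' f _ s, abs_def])
  have "exp (- Re s' * x) \<le> exp (- Re s * x)" if "0 < x" for x
    using that assms(2) by simp
  then show "AE x in lborel. norm (laplace_kernel s' f x) \<le> norm (laplace_kernel s f x)"
    unfolding norm_laplace_kernel
    by (intro AE_I2) (auto simp: indicator_def intro!: mult_right_mono)
qed

lemma laplace_kernel_add: "laplace_kernel s (\<lambda>x. f x + g x) x = laplace_kernel s f x + laplace_kernel s g x"
  by (simp add: laplace_kernel_def algebra_simps)

lemma laplace_kernel_scale: "laplace_kernel s (\<lambda>x. c * f x) x = complex_of_real c * laplace_kernel s f x"
  by (simp add: laplace_kernel_def algebra_simps)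

lemma laplace_add:
  assumes "laplace_integrable f s" "laplace_integrable g s"
  shows "laplace_integrable (\<lambda>x. f x + g x) s" "laplace (\<lambda>x. f x + g x) s = laplace f s + laplace g s"
  using assms by (simp_all add: laplace_integrable_iff laplace_eq laplace_kernel_add[abs_def])

lemma laplace_scale:
  assumes "laplace_integrable f s"
  shows "laplace_integrable (\<lambda>x. c * f x) s" "laplace (\<lambda>x. c * f x) s = complex_of_real c * laplace f s"
  using assms by (simp_all add: laplace_integrable_iff laplace_eq laplace_kernel_scale[abs_def])

lemma laplace_diff:
  assumes "laplace_integrable f s" "laplace_integrable g s"
  shows "laplace_integrable (\<lambda>x. f x - g x) s" "laplace (\<lambda>x. f x - g x) s = laplace f s - laplace g s"
  using laplace_add[OF assms(1) laplace_scale(1)[OF assms(2), of "-1"]] laplace_scale(2)[OF assms(2), of "-1"]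
  by simp_all

lemma integral_exp_minus:
  assumes "a > 0"
  shows "set_integrable lborel {0<..} (\<lambda>x::real. exp (- a * x))"
    and "(LINT x:{0<..}|lborel. exp (- a * x)) = 1 / a"
proof -
  have lim0: "(((\<lambda>x. - exp (- a * x) / a) \<circ> real_of_ereal) \<longlongrightarrow> - 1 / a) (at_right 0)"
    unfolding zero_ereal_def ereal_tendsto_simps
    using assms by (auto intro!: tendsto_eq_intros)
  have "((\<lambda>x. exp (- (a * x))) \<longlongrightarrow> 0) at_top"
    by (rule filterlim_compose[OF exp_at_bot])
      (auto simp: filterlim_uminus_at_bot intro!: filterlim_tendsto_pos_mult_at_top[OF tendsto_const assms filterlim_ident])
  then have "((\<lambda>x. - exp (- (a * x)) / a) \<longlongrightarrow> - 0 / a) at_top"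
    using assms by (intro tendsto_divide tendsto_minus tendsto_const) auto
  then have lim_inf: "(((\<lambda>x. - exp (- a * x) / a) \<circ> real_of_ereal) \<longlongrightarrow> 0) (at_left \<infinity>)"
    unfolding ereal_tendsto_simps by simp
  have deriv: "((\<lambda>x. - exp (- a * x) / a) has_real_derivative exp (- a * x)) (at x)" for x
    using assms by (auto intro!: derivative_eq_intros)
  have *: "einterval 0 \<infinity> = {0<..}"
    by (auto simp: einterval_def zero_ereal_def)
  show "set_integrable lborel {0<..} (\<lambda>x::real. exp (- a * x))"
    using interval_integral_FTC_nonneg(1)[OF _ deriv _ _ lim0 lim_inf] by (simp add: *)
  show "(LINT x:{0<..}|lborel. exp (- a * x)) = 1 / a"
    using interval_integral_FTC_nonneg(2)[OF _ deriv _ _ lim0 lim_inf]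
    by (simp add: * interval_lebesgue_integral_le_eq)
qed

lemma laplace_bounded:
  assumes f: "continuous_on {0..} f" and le: "\<And>x. 0 < x \<Longrightarrow> \<bar>f x\<bar> \<le> C" and s: "Re s > 0"
  shows "laplace_integrable f s" "norm (laplace f s) \<le> C / Re s"
proof -
  have int: "integrable lborel (\<lambda>x. C * (indicator {0<..} x * exp (- Re s * x)))"
    using integral_exp_minus(1)[OF s] by (simp add: set_integrable_def)
  have le': "norm (laplace_kernel s f x) \<le> C * (indicator {0<..} x * exp (- Re s * x))" for x
    unfolding norm_laplace_kernel by (auto simp: indicator_def mult.commute intro!: mult_right_mono le)
  have "continuous_on {0<..} (\<lambda>x. exp (- s * complex_of_real x) * complex_of_real (f x))"
    by (intro continuous_intros continuous_on_subset[OF f]) auto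
  then have "(\<lambda>x. indicator {0<..} x *\<^sub>R (exp (- s * complex_of_real x) * complex_of_real (f x))) \<in> borel_measurable borel"
    by (rule borel_measurable_continuous_on_indicator[rotated]) simp
  then have "laplace_kernel s f \<in> borel_measurable lborel"
    by (simp add: laplace_kernel_def[abs_def])
  then have "integrable lborel (laplace_kernel s f)"
    by (rule Bochner_Integration.integrable_bound[OF int]) (auto intro!: AE_I2 order_trans[OF le'])
  then show "laplace_integrable f s"
    by (simp add: laplace_integrable_iff)
  have "norm (laplace f s) \<le> (\<integral>x. C * (indicator {0<..} x * exp (- Re s * x)) \<partial>lborel)"
    unfolding laplace_eq
    by (intro order_trans[OF integral_norm_bound integral_mono])
      (use int le' \<open>integrable lborel (laplace_kernel s f)\<close> in auto)
  also have "\<dots> = C / Re s"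
    using integral_exp_minus(2)[OF s] by (simp add: set_lebesgue_integral_def)
  finally show "norm (laplace f s) \<le> C / Re s" .
qed

lemma laplace_J:
  assumes "Re s > 0"
  shows "laplace_integrable (at_time J) s" "laplace (at_time J) s = 1 / s"
proof -
  have s: "s \<noteq> 0" using assms by auto
  show int: "laplace_integrable (at_time J) s"
    by (rule laplace_bounded(1)[of _ 1]) (auto simp: at_J assms continuous_on_at_time)
  have kernel: "laplace_kernel s (at_time J) x = indicator {0<..} x *\<^sub>R exp (- s * complex_of_real x)" for x
    by (auto simp: laplace_kernel_def indicator_def at_J)
  have *: "einterval 0 \<infinity> = {0<..}"
    by (auto simp: einterval_def zero_ereal_def)
  have "((\<lambda>x. norm (- exp (- s * complex_of_real x) / s)) \<longlongrightarrow> 0) at_top"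
  proof -
    have "((\<lambda>x. exp (- (Re s * x)) / norm s) \<longlongrightarrow> 0 / norm s) at_top"
      by (intro tendsto_divide tendsto_const filterlim_compose[OF exp_at_bot])
        (auto simp: filterlim_uminus_at_bot s intro!: filterlim_tendsto_pos_mult_at_top[OF tendsto_const assms filterlim_ident])
    then show ?thesis
      by (simp add: norm_divide)
  qed
  then have lim_inf: "(((\<lambda>x. - exp (- s * complex_of_real x) / s) \<circ> real_of_ereal) \<longlongrightarrow> 0) (at_left \<infinity>)"
    unfolding ereal_tendsto_simps by (rule tendsto_norm_zero_cancel)
  have lim0: "(((\<lambda>x. - exp (- s * complex_of_real x) / s) \<circ> real_of_ereal) \<longlongrightarrow> - 1 / s) (at_right 0)"
    unfolding zero_ereal_def ereal_tendsto_simps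
    by (auto intro!: tendsto_eq_intros simp: s)
  have "(LBINT x=0..\<infinity>. exp (- s * complex_of_real x)) = 0 - (- 1 / s)"
  proof (rule interval_integral_FTC_integrable[OF _ _ _ _ lim0 lim_inf])
    fix x :: real
    have "((\<lambda>z. - exp (- s * z) / s) has_field_derivative exp (- s * of_real x)) (at (of_real x))"
      using s by (auto intro!: derivative_eq_intros)
    then show "((\<lambda>x. - exp (- s * complex_of_real x) / s) has_vector_derivative exp (- s * complex_of_real x)) (at x)"
      by (rule has_vector_derivative_real_field)
  next
    show "set_integrable lborel (einterval 0 \<infinity>) (\<lambda>x. exp (- s * complex_of_real x))"
      using int unfolding laplace_integrable_iff set_integrable_def * by (simp add: kernel[abs_def])
  qed (auto intro!: continuous_intros)
  then show "laplace (at_time J) s = 1 / s"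
    by (simp add: laplace_eq kernel[abs_def] interval_lebesgue_integral_le_eq * set_lebesgue_integral_def)
qed

text \<open>The exponential factors as exp (- s (x - y)) exp (- s y), so with integrands extended by
  zero to the whole line this is Fubini for F (x - y) G y. Translation invariance makes the inner
  integral, and that of the norm, independent of y.\<close>

lemma laplace_mult:
  assumes f: "laplace_integrable (at_time f) s" and g: "laplace_integrable (at_time g) s"
  shows "laplace_integrable (at_time (f * g)) s"
    and "laplace (at_time (f * g)) s = laplace (at_time f) s * laplace (at_time g) s"
proof -
  define F where "F = laplace_kernel s (at_time f)"
  define G where "G = laplace_kernel s (at_time g)"
  have F: "integrable lborel F" and G: "integrable lborel G"
    using f g by (simp_all add: F_def G_def laplace_integrable_iff)
  have [measurable]: "F \<in> borel_measurable borel" "G \<in> borel_measurable borel"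
    using borel_measurable_integrable[OF F] borel_measurable_integrable[OF G] by simp_all
  have shift_int: "integrable lborel (\<lambda>x. F (x - y))" for y
    using lborel_integrable_real_affine[OF F, of 1 "- y"] by (simp add: add.commute)
  have shift: "(\<integral>x. F (x - y) \<partial>lborel) = integral\<^sup>L lborel F"
    and shift_norm: "(\<integral>x. norm (F (x - y)) \<partial>lborel) = (\<integral>x. norm (F x) \<partial>lborel)" for y
    using lborel_integral_real_affine[of 1 F "- y"] lborel_integral_real_affine[of 1 "\<lambda>x. norm (F x)" "- y"]
    by (simp_all add: add.commute)
  define H where "H y x = F (x - y) * G y" for x y
  have [measurable]: "case_prod H \<in> borel_measurable (lborel \<Otimes>\<^sub>M lborel)"
    unfolding H_def[abs_def] by measurable
  have H: "integrable (lborel \<Otimes>\<^sub>M lborel) (case_prod H)"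
  proof (rule lborel_pair.Fubini_integrable)
    have "(\<lambda>y. \<integral>x. norm (case (y, x) of (y, x) \<Rightarrow> H y x) \<partial>lborel) = (\<lambda>y. (\<integral>x. norm (F x) \<partial>lborel) * norm (G y))"
      by (simp add: H_def norm_mult shift_norm)
    then show "integrable lborel (\<lambda>y. \<integral>x. norm (case (y, x) of (y, x) \<Rightarrow> H y x) \<partial>lborel)"
      using G by simp
    show "AE y in lborel. integrable lborel (\<lambda>x. case (y, x) of (y, x) \<Rightarrow> H y x)"
      using shift_int by (auto simp: H_def)
  qed measurable
  have row: "(\<integral>y. H y x \<partial>lborel) = laplace_kernel s (at_time (f * g)) x" for x
  proof (cases "x > 0")
    case True
    have cont: "continuous_on {0..x} (\<lambda>y. at_time f (x - y) * at_time g y)"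
      by (rule continuous_on_conv_integrand) (rule continuous_on_at_time)+
    have "set_integrable lborel {0<..<x} (\<lambda>y. at_time f (x - y) * at_time g y)"
      by (rule set_integrable_subset[OF borel_integrable_atLeastAtMost'[OF cont]]) auto
    then have "(LINT y:{0<..<x}|lborel. at_time f (x - y) * at_time g y) = at_time (f * g) x"
      unfolding at_time_mult conv_def by (simp add: set_borel_integral_eq_integral(2) integral_open_interval_real)
    moreover have "H y x = exp (- s * complex_of_real x) *
        complex_of_real (indicator {0<..<x} y *\<^sub>R (at_time f (x - y) * at_time g y))" for y
    proof -
      have "exp (- s * complex_of_real (x - y)) * exp (- s * complex_of_real y) = exp (- s * complex_of_real x)"
        by (simp add: algebra_simps flip: exp_add)
      then show ?thesis
        by (auto simp: H_def F_def G_def laplace_kernel_def indicator_def mult_ac)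
    qed
    ultimately show ?thesis
      using True
      by (simp only: integral_mult_right_zero integral_complex_of_real)
        (simp add: laplace_kernel_def set_lebesgue_integral_def)
  next
    case False
    then have "H y x = 0" for y
      by (auto simp: H_def F_def G_def laplace_kernel_def indicator_def)
    with False show ?thesis
      by (simp add: laplace_kernel_def)
  qed
  show "laplace_integrable (at_time (f * g)) s"
    using lborel_pair.integrable_snd[OF H] by (simp add: row laplace_integrable_iff)
  have "laplace (at_time (f * g)) s = (\<integral>y. (\<integral>x. H y x \<partial>lborel) \<partial>lborel)"
    unfolding laplace_eq row[symmetric, abs_def] by (rule lborel_pair.Fubini_integral[OF H])
  also have "\<dots> = (\<integral>y. integral\<^sup>L lborel F * G y \<partial>lborel)"
    by (simp add: H_def shift)
  finally show "laplace (at_time (f * g)) s = laplace (at_time f) s * laplace (at_time g) s"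
    by (simp add: laplace_eq F_def G_def)
qed

section \<open>Uniqueness of the original\<close>

text \<open>
  Lerch's argument: in the variable \<open>y = exp (- x)\<close> the transform at \<open>\<sigma> + n\<close> is the \<open>n\<close>-th moment of
  \<open>\<psi>\<close>, and by Weierstrass's theorem a function all of whose moments vanish is zero.
\<close>

lemma exp_moments_zero:
  fixes \<psi> :: "real \<Rightarrow> real"
  assumes int: "\<And>n::nat. set_integrable lborel {0<..} (\<lambda>x. exp (- x) ^ n * \<psi> x)"
    and zero: "\<And>n::nat. (LINT x:{0<..}|lborel. exp (- x) ^ n * \<psi> x) = 0"
    and G: "continuous_on {0..1} G"
  shows "set_integrable lborel {0<..} (\<lambda>x. G (exp (- x)) * \<psi> x)"
    and "(LINT x:{0<..}|lborel. G (exp (- x)) * \<psi> x) = 0"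
proof -
  have psi: "set_integrable lborel {0<..} \<psi>"
    using int[of 0] by simp
  have mem: "exp (- x) \<in> {0..1}" if "0 < x" for x :: real
    using that by simp
  have "continuous_on {0<..} (\<lambda>x. G (exp (- x)))"
    by (intro continuous_on_compose2[OF G] continuous_intros) auto
  then have meas: "(\<lambda>x. indicator {0<..} x *\<^sub>R G (exp (- x))) \<in> borel_measurable borel"
    by (rule borel_measurable_continuous_on_indicator[rotated]) simp
  have "bounded (G ` {0..1})"
    by (intro compact_imp_bounded compact_continuous_image[OF G] compact_Icc)
  then obtain B where B: "\<And>y. y \<in> {0..1} \<Longrightarrow> \<bar>G y\<bar> \<le> B"
    unfolding bounded_iff by (metis imageI real_norm_def)
  show G_int: "set_integrable lborel {0<..} (\<lambda>x. G (exp (- x)) * \<psi> x)"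
  proof (rule set_integrable_bound[of _ _ "\<lambda>x. B * \<psi> x"])
    show "set_integrable lborel {0<..} (\<lambda>x. B * \<psi> x)"
      using psi by simp
    have "(\<lambda>x. (indicator {0<..} x *\<^sub>R G (exp (- x))) * (indicator {0<..} x *\<^sub>R \<psi> x)) \<in> borel_measurable lborel"
      using borel_measurable_integrable[OF psi[unfolded set_integrable_def]] meas
      by (intro borel_measurable_times) simp_all
    also have "(\<lambda>x. (indicator {0<..} x *\<^sub>R G (exp (- x))) * (indicator {0<..} x *\<^sub>R \<psi> x)) =
        (\<lambda>x. indicator {0<..} x *\<^sub>R (G (exp (- x)) * \<psi> x))"
      by (auto simp: indicator_def)
    finally show "set_borel_measurable lborel {0<..} (\<lambda>x. G (exp (- x)) * \<psi> x)"
      by (simp add: set_borel_measurable_def)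
    have "\<bar>G (exp (- x))\<bar> \<le> \<bar>B\<bar>" if "0 < x" for x
      using B[OF mem[OF that]] by linarith
    then show "AE x in lborel. x \<in> {0<..} \<longrightarrow> norm (G (exp (- x)) * \<psi> x) \<le> norm (B * \<psi> x)"
      by (auto simp: abs_mult intro!: mult_right_mono AE_I2)
  qed
  define N where "N = (LINT x:{0<..}|lborel. \<bar>\<psi> x\<bar>)"
  have abs_psi: "set_integrable lborel {0<..} (\<lambda>x. \<bar>\<psi> x\<bar>)"
    using psi by (rule set_integrable_abs)
  \<comment> \<open>Replacing G by a polynomial within e changes the integral by at most e N, and
    the polynomial contributes a combination of vanishing moments.\<close>
  have small: "\<bar>LINT x:{0<..}|lborel. G (exp (- x)) * \<psi> x\<bar> \<le> e * N" if e: "e > 0" for e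
  proof -
    obtain p where p: "real_polynomial_function p" and Gp: "\<And>y. y \<in> {0..1} \<Longrightarrow> \<bar>G y - p y\<bar> < e"
      using Stone_Weierstrass_real_polynomial_function[OF compact_Icc G e] by blast
    obtain a n where p_eq: "p = (\<lambda>y. \<Sum>i\<le>n. a i * y ^ i)"
      using p unfolding real_polynomial_function_iff_sum by blast
    have term_int: "integrable lborel (\<lambda>x. a i * (indicator {0<..} x *\<^sub>R (exp (- x) ^ i * \<psi> x)))" for i
      by (intro integrable_mult_right int[unfolded set_integrable_def])
    have p_sum: "(\<lambda>x. indicator {0<..} x *\<^sub>R (p (exp (- x)) * \<psi> x)) =
        (\<lambda>x. \<Sum>i\<le>n. a i * (indicator {0<..} x *\<^sub>R (exp (- x) ^ i * \<psi> x)))"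
      by (simp add: p_eq sum_distrib_right sum_distrib_left mult_ac)
    have p_int: "set_integrable lborel {0<..} (\<lambda>x. p (exp (- x)) * \<psi> x)"
      unfolding set_integrable_def p_sum by (intro Bochner_Integration.integrable_sum term_int)
    have "(LINT x:{0<..}|lborel. p (exp (- x)) * \<psi> x) = (\<Sum>i\<le>n. \<integral>x. a i * (indicator {0<..} x *\<^sub>R (exp (- x) ^ i * \<psi> x)) \<partial>lborel)"
      unfolding set_lebesgue_integral_def p_sum by (intro Bochner_Integration.integral_sum term_int)
    also have "\<dots> = 0"
      using zero by (simp add: set_lebesgue_integral_def)
    finally have "(LINT x:{0<..}|lborel. G (exp (- x)) * \<psi> x) = (LINT x:{0<..}|lborel. G (exp (- x)) * \<psi> x - p (exp (- x)) * \<psi> x)"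
      using set_integral_diff(2)[OF G_int p_int] by simp
    also have "\<bar>\<dots>\<bar> \<le> (LINT x:{0<..}|lborel. \<bar>G (exp (- x)) * \<psi> x - p (exp (- x)) * \<psi> x\<bar>)"
      using set_integral_norm_bound[OF set_integral_diff(1)[OF G_int p_int]] by simp
    also have "\<dots> \<le> (LINT x:{0<..}|lborel. e * \<bar>\<psi> x\<bar>)"
    proof (rule set_integral_mono)
      show "set_integrable lborel {0<..} (\<lambda>x. \<bar>G (exp (- x)) * \<psi> x - p (exp (- x)) * \<psi> x\<bar>)"
        by (rule set_integrable_abs[OF set_integral_diff(1)[OF G_int p_int]])
      show "set_integrable lborel {0<..} (\<lambda>x. e * \<bar>\<psi> x\<bar>)"
        using abs_psi by simp
      fix x :: real assume "x \<in> {0<..}"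
      then have "\<bar>G (exp (- x)) - p (exp (- x))\<bar> \<le> e"
        using Gp[OF mem[of x]] by simp
      then show "\<bar>G (exp (- x)) * \<psi> x - p (exp (- x)) * \<psi> x\<bar> \<le> e * \<bar>\<psi> x\<bar>"
        by (simp add: abs_mult mult_right_mono flip: left_diff_distrib)
    qed
    finally show ?thesis
      by (simp add: N_def)
  qed
  have "\<bar>LINT x:{0<..}|lborel. G (exp (- x)) * \<psi> x\<bar> \<le> 0"
  proof (rule field_le_epsilon)
    fix d :: real assume d: "d > 0"
    have N: "0 \<le> N"
      unfolding N_def set_lebesgue_integral_def by (intro integral_nonneg_AE AE_I2) simp
    have "d / (N + 1) * N \<le> d"
      using d N by (simp add: field_simps)
    with small[of "d / (N + 1)"] d N
    show "\<bar>LINT x:{0<..}|lborel. G (exp (- x)) * \<psi> x\<bar> \<le> 0 + d" by simp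
  qed
  then show "(LINT x:{0<..}|lborel. G (exp (- x)) * \<psi> x) = 0" by simp
qed

text \<open>If \<psi> were nonzero at x0, a tent function of exp (- x) supported where \<psi> keeps
  its sign would make the product nonnegative with zero integral, hence zero at x0 by
  continuity.\<close>

lemma exp_moments_zero_imp_zero:
  fixes \<psi> :: "real \<Rightarrow> real"
  assumes int: "\<And>n::nat. set_integrable lborel {0<..} (\<lambda>x. exp (- x) ^ n * \<psi> x)"
    and zero: "\<And>n::nat. (LINT x:{0<..}|lborel. exp (- x) ^ n * \<psi> x) = 0"
    and cont: "continuous_on {0<..} \<psi>" and x0: "0 < x0"
  shows "\<psi> x0 = 0"
proof (rule ccontr)
  assume ne: "\<psi> x0 \<noteq> 0"
  have "isCont \<psi> x0"
    using cont x0 by (simp add: continuous_on_eq_continuous_at)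
  moreover have "0 < \<bar>\<psi> x0\<bar>"
    using ne by simp
  ultimately obtain \<delta>' where \<delta>': "\<delta>' > 0"
    and near: "\<And>x. \<bar>x - x0\<bar> < \<delta>' \<Longrightarrow> \<bar>\<psi> x - \<psi> x0\<bar> < \<bar>\<psi> x0\<bar>"
    unfolding continuous_at_eps_delta dist_real_def by blast
  define \<delta> where "\<delta> = min \<delta>' x0"
  have \<delta>: "\<delta> > 0"
    using \<delta>' x0 by (simp add: \<delta>_def)
  have ball: "0 < \<psi> x0 * \<psi> x" if "\<bar>x - x0\<bar> < \<delta>" for x
    using near[of x] that by (cases "0 < \<psi> x0") (auto simp: \<delta>_def zero_less_mult_iff)
  have "isCont ln (exp (- x0))"
    by (intro isCont_ln) simp
  then obtain d where d: "d > 0" and ln_d: "\<And>y. \<bar>y - exp (- x0)\<bar> < d \<Longrightarrow> \<bar>ln y + x0\<bar> < \<delta>"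
    using \<delta> unfolding continuous_at_eps_delta by (force simp: dist_real_def)
  \<comment> \<open>The factor \<open>\<psi> x0\<close> gives the tent the sign of \<psi> near x0;
    its half-width d was chosen through \<open>ln\<close> so that nearness of the exponentials
    forces nearness of x to x0.\<close>
  define G where "G y = \<psi> x0 * max 0 (d - \<bar>y - exp (- x0)\<bar>)" for y
  have "continuous_on {0..1} G"
    unfolding G_def by (intro continuous_intros)
  note G = exp_moments_zero[OF int zero this]
  define q where "q x = G (exp (- x)) * \<psi> x" for x
  have q_nonneg: "0 \<le> q x" for x
  proof (cases "\<bar>exp (- x) - exp (- x0)\<bar> < d")
    case True
    then have "\<bar>x - x0\<bar> < \<delta>"
      using ln_d[of "exp (- x)"] by simp
    then have "0 \<le> \<psi> x0 * \<psi> x * max 0 (d - \<bar>exp (- x) - exp (- x0)\<bar>)"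
      by (intro mult_nonneg_nonneg[OF less_imp_le[OF ball]]) auto
    then show ?thesis
      by (simp add: q_def G_def mult_ac)
  qed (simp add: q_def G_def)
  \<comment> \<open>A compact interval around x0 that stays away from 0, where \<psi> may fail to be
    continuous.\<close>
  define I where "I = {x0 / 2..x0 + 1}"
  have q_cont: "continuous_on I q"
    unfolding q_def G_def I_def using x0
    by (intro continuous_intros continuous_on_subset[OF cont]) auto
  have q_int: "set_integrable lborel I q"
    using q_cont unfolding I_def by (rule borel_integrable_atLeastAtMost')
  have "(LINT x:I|lborel. q x) \<le> (LINT x:{0<..}|lborel. q x)"
    unfolding set_lebesgue_integral_def
  proof (rule integral_mono)
    show "integrable lborel (\<lambda>x. indicator I x *\<^sub>R q x)"
      using q_int by (simp add: set_integrable_def)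
    show "integrable lborel (\<lambda>x. indicator {0<..} x *\<^sub>R q x)"
      using G(1) by (simp add: set_integrable_def q_def)
    show "indicator I x *\<^sub>R q x \<le> indicator {0<..} x *\<^sub>R q x" for x
      using q_nonneg[of x] x0 by (auto simp: I_def indicator_def)
  qed
  also have "\<dots> = 0"
    using G(2) by (simp add: q_def)
  finally have "integral I q \<le> 0"
    using set_borel_integral_eq_integral(2)[OF q_int] by simp
  moreover have q_hk: "q integrable_on I"
    using q_cont unfolding I_def by (rule integrable_continuous_interval)
  then have "0 \<le> integral I q"
    by (rule integral_nonneg) (rule q_nonneg)
  ultimately have "(q has_integral 0) (cbox (x0 / 2) (x0 + 1))"
    using q_hk by (simp add: has_integral_iff I_def)
  then have "q x0 = 0"
    using q_cont q_nonneg x0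
    by (intro has_integral_0_cbox_imp_0[of "x0 / 2" "x0 + 1" q]) (auto simp: I_def box_real)
  then show False
    using ne d by (simp add: q_def G_def)
qed

lemma laplace_unique:
  assumes f: "continuous_on {0<..} f" and g: "continuous_on {0<..} g"
    and lf: "\<And>s. Re s > c \<Longrightarrow> laplace_integrable f s \<and> laplace f s = F s"
    and lg: "\<And>s. Re s > c \<Longrightarrow> laplace_integrable g s \<and> laplace g s = F s"
    and x: "0 < x"
  shows "f x = g x"
proof -
  define \<sigma> where "\<sigma> = \<bar>c\<bar> + 1"
  define \<phi> where "\<phi> x = f x - g x" for x
  define \<psi> where "\<psi> x = exp (- \<sigma> * x) * \<phi> x" for x
  have eq: "laplace_kernel (complex_of_real (\<sigma> + real n)) \<phi> =
      (\<lambda>x. complex_of_real (indicator {0<..} x *\<^sub>R (exp (- x) ^ n * \<psi> x)))" for n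
  proof
    fix x :: real
    have "exp (- complex_of_real (\<sigma> + real n) * complex_of_real x) = complex_of_real (exp (- (\<sigma> + real n) * x))"
      by (simp only: exp_of_real[symmetric] of_real_mult of_real_minus)
    also have "exp (- (\<sigma> + real n) * x) = exp (- x) ^ n * exp (- \<sigma> * x)"
      by (simp add: algebra_simps flip: exp_add exp_of_nat_mult)
    finally show "laplace_kernel (complex_of_real (\<sigma> + real n)) \<phi> x =
        complex_of_real (indicator {0<..} x *\<^sub>R (exp (- x) ^ n * \<psi> x))"
      by (simp add: laplace_kernel_def \<psi>_def scaleR_conv_of_real mult_ac)
  qed
  have \<phi>: "laplace_integrable \<phi> s" "laplace \<phi> s = 0" if "Re s > c" for s
    using laplace_diff[of f s g] lf[OF that] lg[OF that] by (simp_all add: \<phi>_def[abs_def])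
  have Re: "Re (complex_of_real (\<sigma> + real n)) > c" for n
    by (simp add: \<sigma>_def)
  have "\<psi> x = 0"
  proof (rule exp_moments_zero_imp_zero[OF _ _ _ x])
    show "set_integrable lborel {0<..} (\<lambda>x. exp (- x) ^ n * \<psi> x)" for n
      using \<phi>(1)[OF Re[of n]] unfolding laplace_integrable_iff eq complex_of_real_integrable_eq set_integrable_def .
    show "(LINT x:{0<..}|lborel. exp (- x) ^ n * \<psi> x) = 0" for n
      using \<phi>(2)[OF Re[of n]] unfolding laplace_eq eq integral_complex_of_real set_lebesgue_integral_def
      by (simp only: of_real_eq_0_iff)
    show "continuous_on {0<..} \<psi>"
      unfolding \<psi>_def \<phi>_def by (intro continuous_intros f g)
  qed
  then show ?thesis
    by (simp add: \<psi>_def \<phi>_def)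
qed

lemma inv_laplace_eqI:
  assumes "is_inv_laplace F f"
  shows "inv_laplace F = f"
  unfolding inv_laplace_def
proof (rule the_equality[where P = "is_inv_laplace F" and a = f, OF assms])
  fix g assume g: "is_inv_laplace F g"
  obtain c d where
    c: "\<And>s. Re s > c \<Longrightarrow> laplace_integrable f s \<and> laplace f s = F s" and
    d: "\<And>s. Re s > d \<Longrightarrow> laplace_integrable g s \<and> laplace g s = F s"
    using assms g unfolding is_inv_laplace_def by blast
  show "g = f"
  proof
    fix x
    show "g x = f x"
    proof (cases "0 < x")
      case True
      show ?thesis
        by (rule laplace_unique[where c = "max c d" and F = F, OF _ _ _ _ True])
          (use assms g c d in \<open>auto simp: is_inv_laplace_def\<close>)
    qed (use assms g in \<open>auto simp: is_inv_laplace_def not_less\<close>)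
  qed
qed

section \<open>The reflection coefficient\<close>

text \<open>\<open>bessel_square\<close> determines s M up to sign. The sign follows from s M = 1 /
  \<mu> + N, where N is the transform of the kernel's derivative and |N| \<le> 1 / (\<mu>^2 Re s);
  this is less than 1 / \<mu> exactly when Re s > 1 / \<mu>, so s M has positive real part and is
  the principal root.\<close>

lemma laplace_bessel:
  assumes mu: "\<mu> > 0" and s: "Re s > 1 / \<mu>"
  defines "M \<equiv> laplace (at_time (bessel \<mu>)) s"
  shows "laplace_integrable (at_time (bessel \<mu>)) s"
    and "s * M = lambda_plus \<mu> s"
    and "Re (s * M) > 0"
proof -
  define n where "n = bessel' \<mu>"
  have "0 < 1 / \<mu>" using mu by simp
  then have s0: "Re s > 0" using s by linarith
  then have s_ne: "s \<noteq> 0" by auto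
  have n: "laplace_integrable (at_time n) s" "norm (laplace (at_time n) s) \<le> 1 / \<mu>\<^sup>2 / Re s"
    using laplace_bounded[OF continuous_on_at_time[of n] _ s0, of "1 / \<mu>\<^sup>2"] abs_bessel'_le[OF mu]
    by (simp_all add: n_def)
  note J = laplace_J[OF s0]
  have m: "at_time (bessel \<mu>) = (\<lambda>x. at_time (J * n) x + 1 / \<mu> * at_time J x)"
    using arg_cong[OF J_mult_bessel'[OF mu], of at_time] by (simp add: n_def fun_eq_iff)
  note Jn = laplace_mult[OF J(1) n(1)]
  show mi: "laplace_integrable (at_time (bessel \<mu>)) s"
    unfolding m by (intro laplace_add(1) laplace_scale(1) Jn J)
  have "M = 1 / s * laplace (at_time n) s + complex_of_real (1 / \<mu>) * (1 / s)"
    unfolding M_def m laplace_add(2)[OF Jn(1) laplace_scale(1)[OF J(1)]] laplace_scale(2)[OF J(1)] Jn(2) J(2) ..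
  then have sM: "s * M = laplace (at_time n) s + complex_of_real (1 / \<mu>)"
    using s_ne by (simp add: field_simps)
  have "1 / \<mu>\<^sup>2 / Re s < 1 / \<mu>"
    using s mu s0 by (simp add: field_simps power2_eq_square)
  then have "- Re (laplace (at_time n) s) < 1 / \<mu>"
    using n(2) abs_Re_le_cmod[of "laplace (at_time n) s"] by linarith
  then show pos: "Re (s * M) > 0"
    unfolding sM by simp
  note mm = laplace_mult[OF mi mi]
  note JJ = laplace_mult[OF J(1) J(1)]
  note JJmm = laplace_mult[OF JJ(1) mm(1)]
  have "(\<lambda>x. \<mu>\<^sup>2 * at_time (bessel \<mu> * bessel \<mu>) x + at_time (J * J * (bessel \<mu> * bessel \<mu>)) x) = at_time (J * J)"
    using arg_cong[OF bessel_square[OF mu], of at_time] by (simp add: fun_eq_iff)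
  then have "complex_of_real (\<mu>\<^sup>2) * (M * M) + (1 / s * (1 / s)) * (M * M) = 1 / s * (1 / s)"
    using laplace_add(2)[OF laplace_scale(1)[OF mm(1), of "\<mu>\<^sup>2"] JJmm(1)]
    by (simp only: laplace_scale(2)[OF mm(1)] JJmm(2) mm(2) JJ(2) J(2) M_def)
  then have "s * s * (complex_of_real (\<mu>\<^sup>2) * (M * M) + (1 / s * (1 / s)) * (M * M)) = s * s * (1 / s * (1 / s))"
    by simp
  then have M2: "M * M * (1 + (complex_of_real \<mu>)\<^sup>2 * s\<^sup>2) = 1"
    using s_ne by (simp add: algebra_simps power2_eq_square)
  then have "1 + (complex_of_real \<mu>)\<^sup>2 * s\<^sup>2 \<noteq> 0"
    by force
  with M2 have "M * M = 1 / (1 + (complex_of_real \<mu>)\<^sup>2 * s\<^sup>2)"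
    by (simp add: field_simps)
  moreover have "(s * M)\<^sup>2 = s\<^sup>2 * (M * M)"
    by (simp add: power2_eq_square mult_ac)
  ultimately have "s\<^sup>2 / (1 + (complex_of_real \<mu>)\<^sup>2 * s\<^sup>2) = (s * M)\<^sup>2"
    by simp
  then show "s * M = lambda_plus \<mu> s"
    unfolding lambda_plus_def using csqrt_square[of "s * M"] pos by simp
qed

lemma laplace_refl_kernel:
  assumes mu: "\<mu> > 0" and s: "Re s > 1 / \<mu>"
  shows "laplace_integrable (at_time (refl_kernel \<mu>)) s"
    and "laplace (at_time (refl_kernel \<mu>)) s = 1 - refl_coeff \<mu> s"
proof -
  define M where "M = laplace (at_time (bessel \<mu>)) s"
  define K where "K = laplace (at_time (refl_kernel \<mu>)) s"
  have "0 < 1 / \<mu>" using mu by simp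
  then have s0: "Re s > 0" using s by linarith
  then have s_ne: "s \<noteq> 0" by auto
  note m = laplace_bessel[OF mu s, folded M_def]
  note J = laplace_J[OF s0]
  note JJ = laplace_mult[OF J(1) J(1)]
  have "at_time (refl_kernel \<mu>) =
      (\<lambda>x. 2 * at_time (bessel \<mu>) x + 2 / \<mu>\<^sup>2 * (at_time (J * J * bessel \<mu>) x - at_time (J * J) x))"
    by (simp add: refl_kernel_def fun_eq_iff)
  then show k: "laplace_integrable (at_time (refl_kernel \<mu>)) s"
    by (simp only:) (intro laplace_add laplace_scale laplace_diff laplace_mult m(1) J(1))
  note mk = laplace_mult[OF m(1) k]
  have "(\<lambda>x. at_time (refl_kernel \<mu>) x + at_time (bessel \<mu> * refl_kernel \<mu>) x) = (\<lambda>x. 2 * at_time (bessel \<mu>) x)"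
    using arg_cong[OF refl_kernel_eq[OF mu], of at_time] by (simp add: fun_eq_iff)
  then have K: "K + M * K = 2 * M"
    using laplace_add(2)[OF k mk(1)] laplace_scale(2)[OF m(1), of 2]
    unfolding mk(2) M_def K_def by simp
  \<comment> \<open>With M = -1 the equation for K would read 0 = -2.\<close>
  have "1 + M \<noteq> 0"
  proof
    assume "1 + M = 0"
    then have "M = -1" by (simp add: add_eq_0_iff)
    with K show False by simp
  qed
  moreover from K have "K * (1 + M) = 2 * M"
    by (simp add: algebra_simps)
  moreover have "refl_coeff \<mu> s = (s * (1 - M)) / (s * (1 + M))"
    unfolding refl_coeff_def lambda_minus_def m(2)[symmetric] by (simp add: algebra_simps)
  then have "refl_coeff \<mu> s = (1 - M) / (1 + M)"
    using s_ne by simp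
  ultimately have "(K + refl_coeff \<mu> s) * (1 + M) = 1 * (1 + M)"
    unfolding distrib_right[of K] by simp
  then show "K = 1 - refl_coeff \<mu> s"
    using \<open>1 + M \<noteq> 0\<close> unfolding mult_right_cancel[OF \<open>1 + M \<noteq> 0\<close>] by (simp add: algebra_simps)
qed

text \<open>The transform of g - k * g is (1 - (1 - r)) times that of g. It exists to the right of
  both the abscissa known for g and the bound 1 / \<mu> for the kernel, so uniqueness of the
  original applies.\<close>

lemma refl_conv_eq_reflected_wave:
  assumes mu: "\<mu> > 0" and g: "continuous_on {0..} g" and g_int: "\<exists>s. laplace_integrable g s"
  shows "refl_conv \<mu> g = reflected_wave \<mu> g"
  unfolding refl_conv_def
proof (rule inv_laplace_eqI)
  obtain s0 where s0: "laplace_integrable g s0"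
    using g_int by blast
  define \<gamma> where "\<gamma> = causal g"
  define w where "w = \<gamma> - refl_kernel \<mu> * \<gamma>"
  have \<gamma>: "at_time \<gamma> x = g x" if "0 \<le> x" for x
    unfolding \<gamma>_def by (rule at_causal[OF g that])
  have w: "reflected_wave \<mu> g x = at_time w x" if "0 < x" for x
  proof -
    have "conv (at_time (refl_kernel \<mu>)) g x = conv (at_time (refl_kernel \<mu>)) (at_time \<gamma>) x"
      by (rule conv_cong) (simp_all add: \<gamma>)
    with that show ?thesis
      by (simp add: reflected_wave_def w_def at_time_mult \<gamma>)
  qed
  have "continuous_on {0<..} (reflected_wave \<mu> g) \<longleftrightarrow> continuous_on {0<..} (at_time w)"
    by (rule continuous_on_cong) (simp_all add: w)
  moreover have "continuous_on {0<..} (at_time w)"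
    by (rule continuous_on_subset[OF continuous_on_at_time]) auto
  ultimately have "continuous_on {0<..} (reflected_wave \<mu> g)" by simp
  moreover have "laplace_integrable (reflected_wave \<mu> g) s \<and>
      laplace (reflected_wave \<mu> g) s = refl_coeff \<mu> s * laplace g s"
    if s: "max (Re s0) (1 / \<mu>) < Re s" for s
  proof -
    have kernel: "laplace_kernel s (reflected_wave \<mu> g) = laplace_kernel s (at_time w)"
      "laplace_kernel s g = laplace_kernel s (at_time \<gamma>)"
      by (rule laplace_kernel_cong; simp add: w \<gamma>)+
    have "laplace_integrable g s"
      using laplace_integrable_mono[OF s0] s by simp
    then have gi: "laplace_integrable (at_time \<gamma>) s"
      by (simp add: laplace_integrable_iff kernel)
    have s': "Re s > 1 / \<mu>" using s by simp
    note k = laplace_refl_kernel[OF mu s']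
    note kg = laplace_mult[OF k(1) gi]
    have "at_time w = (\<lambda>x. at_time \<gamma> x - at_time (refl_kernel \<mu> * \<gamma>) x)"
      by (simp add: w_def fun_eq_iff)
    with laplace_diff[OF gi kg(1)] have wi: "laplace_integrable (at_time w) s"
      and w_eq: "laplace (at_time w) s = laplace (at_time \<gamma>) s - (1 - refl_coeff \<mu> s) * laplace (at_time \<gamma>) s"
      unfolding kg(2) k(2) by simp_all
    have "laplace (at_time w) s = refl_coeff \<mu> s * laplace (at_time \<gamma>) s"
      unfolding w_eq by (simp add: algebra_simps)
    with wi show ?thesis
      by (simp add: laplace_integrable_iff laplace_eq kernel)
  qed
  moreover have "\<forall>x\<le>0. reflected_wave \<mu> g x = 0"
    by (simp add: reflected_wave_def)
  ultimately show "is_inv_laplace (\<lambda>s. refl_coeff \<mu> s * laplace g s) (reflected_wave \<mu> g)"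
    unfolding is_inv_laplace_def by blast
qed

section \<open>Regularity of the reflected datum\<close>

definition C1_line :: "(real \<Rightarrow> real) \<Rightarrow> bool" where
  "C1_line f \<longleftrightarrow> (\<exists>f'. (\<forall>x. (f has_real_derivative f' x) (at x)) \<and> continuous_on UNIV f')"

lemma C1_line_continuous: "C1_line f \<Longrightarrow> continuous_on X f"
  unfolding C1_line_def by (meson DERIV_isCont continuous_at_imp_continuous_on)

lemma C1_line_add_scaled:
  assumes "C1_line f" "C1_line g"
  shows "C1_line (\<lambda>x. a * f x + b * g x)"
proof -
  obtain f' g' where "\<And>x. (f has_real_derivative f' x) (at x)" "continuous_on UNIV f'"
    "\<And>x. (g has_real_derivative g' x) (at x)" "continuous_on UNIV g'"
    using assms unfolding C1_line_def by blast
  then show ?thesis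
    unfolding C1_line_def
    by (intro exI[of _ "\<lambda>x. a * f' x + b * g' x"]) (auto intro!: derivative_eq_intros continuous_intros)
qed

lemma C1_line_reflect:
  assumes "C1_line f"
  shows "C1_line (reflect f)"
proof -
  obtain f' where f': "\<And>x. (f has_real_derivative f' x) (at x)" "continuous_on UNIV f'"
    using assms unfolding C1_line_def by blast
  have "((\<lambda>x. f (- x)) has_real_derivative - f' (- x)) (at x)" for x
    using DERIV_chain2[where f = f and g = uminus, OF f'(1) DERIV_minus[OF DERIV_ident]] by simp
  moreover have "continuous_on UNIV (\<lambda>x. - f' (- x))"
    by (intro continuous_intros continuous_on_compose2[OF f'(2)]) auto
  ultimately show ?thesis
    unfolding C1_line_def reflect_def[abs_def] by (intro exI[of _ "\<lambda>x. - f' (- x)"]) simp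
qed

text \<open>Since f starts at 0, its extension by zero is continuous across 0, and the primitive is
  continuously differentiable on the whole line.\<close>

lemma C1_line_J_mult:
  assumes f0: "at_time f 0 = 0"
  shows "C1_line (at_time (J * f))"
proof -
  have neg: "at_time f x = 0" if "x \<le> 0" for x
    using that f0 by (cases "x = 0") (auto simp: at_time_neg)
  have "continuous_on {..0} (at_time f) \<longleftrightarrow> continuous_on {..0::real} (\<lambda>_. 0::real)"
    by (rule continuous_on_cong) (auto simp: neg)
  then have "continuous_on ({..0} \<union> {0..}) (at_time f)"
    by (intro continuous_on_closed_Un continuous_on_at_time) auto
  moreover have "{..0::real} \<union> {0..} = UNIV" by auto
  ultimately have cont: "continuous_on UNIV (at_time f)" by simp
  have "(at_time (J * f) has_real_derivative at_time f x) (at x)" for x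
  proof -
    \<comment> \<open>Starting the primitive at - c places x in the interior of the interval of
      integration, whatever its sign; the part left of 0 contributes nothing.\<close>
    define c where "c = \<bar>x\<bar> + 1"
    have "((\<lambda>y. integral {- c..y} (at_time f)) has_vector_derivative at_time f x) (at x within {- c..c})"
      by (intro integral_has_vector_derivative continuous_on_subset[OF cont]) (auto simp: c_def)
    then have "((\<lambda>y. integral {- c..y} (at_time f)) has_real_derivative at_time f x) (at x)"
      by (subst (asm) at_within_Icc_at) (auto simp: c_def has_real_derivative_iff_has_vector_derivative)
    then show ?thesis
    proof (rule has_field_derivative_transform_within_open[of _ _ _ "{- c<..}"])
      fix y assume y: "y \<in> {- c<..}"
      have zero: "integral {- c..z} (at_time f) = 0" if "z \<le> 0" for z
        using integral_cong[of "{- c..z}" "at_time f" "\<lambda>_. 0"] that neg by auto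
      show "integral {- c..y} (at_time f) = at_time (J * f) y"
      proof (cases "y < 0")
        case False
        have "integral {- c..0} (at_time f) + integral {0..y} (at_time f) = integral {- c..y} (at_time f)"
          using False
          by (intro Henstock_Kurzweil_Integration.integral_combine integrable_continuous_interval
              continuous_on_subset[OF cont]) (auto simp: c_def)
        then show ?thesis
          by (simp add: zero at_J_mult)
      qed (simp add: zero at_time_neg)
    qed (auto simp: c_def)
  qed
  with cont show ?thesis
    unfolding C1_line_def by blast
qed

text \<open>From g = \<open>J * g'\<close> the derivative moves past the convolution: g - k * g is
  \<open>J\<close> times g' - k * g'. There is no kink at 0, because g vanishes on the left and
  therefore g' is 0 at 0.\<close>

lemma C1_line_reflected_wave:
  assumes g: "C1_line g" and neg: "\<And>x. x \<le> 0 \<Longrightarrow> g x = 0"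
  shows "C1_line (reflected_wave \<mu> g)"
proof -
  obtain g' where g': "\<And>x. (g has_real_derivative g' x) (at x)" "continuous_on UNIV g'"
    using g unfolding C1_line_def by blast
  have "continuous_on {..0} g'"
    by (rule continuous_on_subset[OF g'(2)]) simp
  moreover have "g' x = 0" if "x < 0" for x
  proof (rule DERIV_unique[OF g'(1)])
    show "(g has_real_derivative 0) (at x)"
      by (rule has_field_derivative_transform_within_open[of "\<lambda>_. 0" _ _ "{..<0}"]) (use that neg in auto)
  qed
  ultimately have g'0: "g' 0 = 0"
    using continuous_constant_on_closure[of "{..<0}" g' 0 0] by simp
  define \<gamma> where "\<gamma> = causal g"
  define \<gamma>' where "\<gamma>' = causal g'"
  have \<gamma>: "at_time \<gamma> x = g x" if "0 \<le> x" for x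
    unfolding \<gamma>_def by (rule at_causal[OF C1_line_continuous[OF g] that])
  have \<gamma>': "at_time \<gamma>' x = g' x" if "0 \<le> x" for x
    unfolding \<gamma>'_def by (rule at_causal[OF continuous_on_subset[OF g'(2)] that]) simp
  have J: "J * \<gamma>' = \<gamma>"
  proof (rule J_mult_eqI)
    show "(at_time \<gamma> has_real_derivative at_time \<gamma>' x) (at x)" if "0 < x" for x
      unfolding \<gamma>'[OF less_imp_le[OF that]]
      by (rule has_field_derivative_transform_within_open[of g _ _ "{0<..}", OF g'(1)])
        (use that \<gamma> in auto)
  qed (simp add: \<gamma> neg)
  have "reflected_wave \<mu> g = at_time (J * (\<gamma>' - refl_kernel \<mu> * \<gamma>'))"
  proof
    fix x :: real
    have *: "J * (\<gamma>' - refl_kernel \<mu> * \<gamma>') = \<gamma> - refl_kernel \<mu> * \<gamma>"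
      unfolding J[symmetric] by (simp add: algebra_simps)
    consider "x < 0" | "x = 0" | "0 < x" by linarith
    then show "reflected_wave \<mu> g x = at_time (J * (\<gamma>' - refl_kernel \<mu> * \<gamma>')) x"
    proof cases
      case 1
      then show ?thesis by (simp add: reflected_wave_def at_time_neg)
    next
      case 2
      then show ?thesis by (simp add: reflected_wave_def)
    next
      case 3
      have "conv (at_time (refl_kernel \<mu>)) g x = at_time (refl_kernel \<mu> * \<gamma>) x"
        unfolding at_time_mult by (rule conv_cong) (simp_all add: \<gamma>)
      with 3 show ?thesis
        unfolding * by (simp add: reflected_wave_def \<gamma>)
    qed
  qed
  moreover have "at_time (\<gamma>' - refl_kernel \<mu> * \<gamma>') 0 = 0"
    by (simp add: \<gamma>' g'0)
  ultimately show ?thesis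
    using C1_line_J_mult by simp
qed

lemma reflected_wave_add_scaled:
  assumes f: "continuous_on {0..} f" and g: "continuous_on {0..} g"
  shows "reflected_wave \<mu> (\<lambda>x. a * f x + b * g x) x = a * reflected_wave \<mu> f x + b * reflected_wave \<mu> g x"
proof -
  have "conv (at_time (refl_kernel \<mu>)) (\<lambda>x. a * f x + b * g x) x =
      a * conv (at_time (refl_kernel \<mu>)) f x + b * conv (at_time (refl_kernel \<mu>)) g x"
    unfolding conv_commute[of "at_time (refl_kernel \<mu>)"]
    by (subst conv_add_left) (auto intro!: continuous_intros f g continuous_on_at_time simp: conv_scale_left)
  then show ?thesis
    by (simp add: reflected_wave_def algebra_simps)
qed

lemma reflected_datum_eq:
  assumes mu: "\<mu> > 0"
    and C1: "C1_line \<eta>0" "C1_line u0"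
    and int: "\<exists>s. laplace_integrable (reflect \<eta>0) s" "\<exists>s. laplace_integrable (reflect u0) s"
  shows "reflected_datum \<mu> (\<eta>0, u0) = ((\<lambda>x. - reflected_wave \<mu> (reflect \<eta>0) x), reflected_wave \<mu> (reflect u0))"
proof -
  have cont: "continuous_on {0..} (reflect \<eta>0)" "continuous_on {0..} (reflect u0)"
    using C1 by (auto intro: C1_line_continuous C1_line_reflect)
  have "\<exists>s. laplace_integrable (\<lambda>x. - reflect \<eta>0 x) s"
    using int(1) laplace_scale(1)[of "reflect \<eta>0" _ "-1"] by auto
  then have "refl_conv \<mu> (\<lambda>x. - reflect \<eta>0 x) = reflected_wave \<mu> (\<lambda>x. - reflect \<eta>0 x)"
    by (intro refl_conv_eq_reflected_wave mu continuous_intros cont)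
  also have "\<dots> = (\<lambda>x. - reflected_wave \<mu> (reflect \<eta>0) x)"
    using reflected_wave_add_scaled[OF cont(1) cont(1), of \<mu> "-1" 0] by (simp add: fun_eq_iff)
  finally have "refl_conv \<mu> (\<lambda>x. - reflect \<eta>0 x) = (\<lambda>x. - reflected_wave \<mu> (reflect \<eta>0) x)" .
  moreover have "refl_conv \<mu> (reflect u0) = reflected_wave \<mu> (reflect u0)"
    by (rule refl_conv_eq_reflected_wave[OF mu cont(2) int(2)])
  moreover have "(\<lambda>x. heaviside x * reflected_wave \<mu> g x) = reflected_wave \<mu> g"
    "(\<lambda>x. - (heaviside x * reflected_wave \<mu> g x)) = (\<lambda>x. - reflected_wave \<mu> g x)" for g
    by (auto simp: heaviside_def reflected_wave_def)
  ultimately show ?thesis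
    by (simp add: reflected_datum_def)
qed

section \<open>D'Alembert's solution\<close>

text \<open>Serves both components of the solution: c = 1 gives \<eta> and c = -1 gives u.\<close>

lemma dAlembert_field:
  fixes c :: real
  assumes T: "0 < T"
    and p: "\<And>x. (p has_real_derivative p' x) (at x)" "continuous_on UNIV p'"
    and q: "\<And>x. (q has_real_derivative q' x) (at x)" "continuous_on UNIV q'"
  defines "f \<equiv> \<lambda>x t. p (x - t) + c * q (x + t)"
  shows "C1_strip UNIV T f"
    and "\<And>x t. Dx UNIV f x t = p' (x - t) + c * q' (x + t)"
    and "\<And>x t. 0 \<le> t \<Longrightarrow> t \<le> T \<Longrightarrow> Dt T f x t = - p' (x - t) + c * q' (x + t)"
proof -
  have cont: "continuous_on UNIV p" "continuous_on UNIV q"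
    using p(1) q(1) by (auto intro: DERIV_isCont continuous_at_imp_continuous_on)
  have "((\<lambda>y. f y t) has_real_derivative p' (x - t) * (1 - 0) + c * (q' (x + t) * (1 + 0))) (at x)" for x t
    unfolding f_def
    by (intro DERIV_add DERIV_cmult DERIV_chain2[OF p(1)] DERIV_chain2[OF q(1)] DERIV_diff DERIV_ident DERIV_const)
  then have dx: "((\<lambda>y. f y t) has_vector_derivative p' (x - t) + c * q' (x + t)) (at x)" for x t
    by (simp add: has_real_derivative_iff_has_vector_derivative)
  have "(f x has_real_derivative p' (x - t) * (0 - 1) + c * (q' (x + t) * (0 + 1))) (at t within {0..T})" for x t
    unfolding f_def
    by (rule has_field_derivative_at_within)
      (intro DERIV_add DERIV_cmult DERIV_chain2[OF p(1)] DERIV_chain2[OF q(1)] DERIV_diff DERIV_ident DERIV_const)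
  then have dt: "(f x has_vector_derivative - p' (x - t) + c * q' (x + t)) (at t within {0..T})" for x t
    by (simp add: has_real_derivative_iff_has_vector_derivative)
  show Dx: "Dx UNIV f x t = p' (x - t) + c * q' (x + t)" for x t
    unfolding Dx_def by (rule vector_derivative_at[OF dx])
  show Dt: "Dt T f x t = - p' (x - t) + c * q' (x + t)" if "0 \<le> t" "t \<le> T" for x t
    unfolding Dt_def using that T
    by (intro vector_derivative_within_closed_interval[OF T _ dt]) auto
  have c1: "continuous_on (UNIV \<times> {0..T}) (\<lambda>z. f (fst z) (snd z))"
    unfolding f_def
    by (intro continuous_intros continuous_on_compose2[OF cont(1)] continuous_on_compose2[OF cont(2)]) auto
  have c2: "continuous_on (UNIV \<times> {0..T}) (\<lambda>z. Dx UNIV f (fst z) (snd z))"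
    unfolding Dx
    by (intro continuous_intros continuous_on_compose2[OF p(2)] continuous_on_compose2[OF q(2)]) auto
  have "continuous_on (UNIV \<times> {0..T}) (\<lambda>z. - p' (fst z - snd z) + c * q' (fst z + snd z))"
    by (intro continuous_intros continuous_on_compose2[OF p(2)] continuous_on_compose2[OF q(2)]) auto
  also have "?this \<longleftrightarrow> continuous_on (UNIV \<times> {0..T}) (\<lambda>z. Dt T f (fst z) (snd z))"
    by (rule continuous_on_cong) (auto simp: Dt)
  finally have c3: "continuous_on (UNIV \<times> {0..T}) (\<lambda>z. Dt T f (fst z) (snd z))" .
  show "C1_strip UNIV T f"
    unfolding C1_strip_def x_C1_def t_C1_def case_prod_beta
    by (intro conjI ballI c1 c2 c3 differentiableI_vector[OF dx] differentiableI_vector[OF dt])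
qed

lemma SV_cauchy_exists:
  assumes T: "0 < T" and a: "C1_line a" and b: "C1_line b"
  shows "\<exists>V. SV_cauchy T (a, b) V"
proof -
  define p where "p x = 1 / 2 * a x + 1 / 2 * b x" for x
  define q where "q x = 1 / 2 * a x + (- 1 / 2) * b x" for x
  have "C1_line p" "C1_line q"
    unfolding p_def[abs_def] q_def[abs_def] by (intro C1_line_add_scaled a b)+
  then obtain p' q' where p': "\<And>x. (p has_real_derivative p' x) (at x)" "continuous_on UNIV p'"
    and q': "\<And>x. (q has_real_derivative q' x) (at x)" "continuous_on UNIV q'"
    unfolding C1_line_def by blast
  define \<eta> where "\<eta> x t = p (x - t) + 1 * q (x + t)" for x t
  define u where "u x t = p (x - t) + (- 1) * q (x + t)" for x t
  note \<eta> = dAlembert_field[OF T p' q', where c = 1, folded \<eta>_def]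
  note u = dAlembert_field[OF T p' q', where c = "- 1", folded u_def]
  have "L_SV UNIV T \<eta> u x t = (0, 0)" if "t \<in> {0<..<T}" for x t
  proof -
    have t: "0 \<le> t" "t \<le> T" using that by auto
    show ?thesis
      unfolding L_SV_def \<eta>(2) u(2) \<eta>(3)[OF t] u(3)[OF t] by simp
  qed
  moreover have "\<eta> x 0 = a x" "u x 0 = b x" for x
    by (simp_all add: \<eta>_def u_def p_def q_def)
  ultimately have "SV_cauchy T (a, b) (\<eta>, u)"
    using \<eta>(1) u(1) by (simp add: SV_cauchy_def SV_classical_def)
  then show ?thesis ..
qed

theorem theorem3p5:
  fixes \<mu> T :: real
    and \<eta>0 u0 :: "real \<Rightarrow> real"
    and \<eta>m um \<eta>p up \<eta>c uc :: "real \<Rightarrow> real \<Rightarrow> real"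
  assumes "\<mu> > 0" and "T > 0"
    and "{x. (\<eta>0 x, u0 x) \<noteq> (0, 0)} \<subseteq> {..<0}"
    and "\<exists>s. laplace_integrable (reflect \<eta>0) s"
    and "\<exists>s. laplace_integrable (reflect u0) s"
    and "hybrid_SV_B \<mu> T (\<eta>0, u0) (\<eta>m, um) (\<eta>p, up)"
    and "SV_cauchy T (\<eta>0, u0) (\<eta>c, uc)"
  shows "(\<exists>V. SV_cauchy T (reflected_datum \<mu> (\<eta>0, u0)) V) \<and>
         (\<forall>\<eta>' u'. SV_cauchy T (reflected_datum \<mu> (\<eta>0, u0)) (\<eta>', u') \<longrightarrow>
            (\<forall>x\<le>0. \<forall>t\<in>{0..T}.
               \<eta>m x t - \<eta>c x t = \<eta>' x t \<and> um x t - uc x t = u' x t))"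
proof -
  note mu = assms(1) and T = assms(2) and cauchy = assms(7)
  have supp: "\<eta>0 x = 0 \<and> u0 x = 0" if "0 \<le> x" for x
    using assms(3) that by force
  \<comment> \<open>The smoothness of the data is read off the classical Cauchy solution at time
    0.\<close>
  have "C1_strip UNIV T \<eta>c" "C1_strip UNIV T uc" "\<eta>0 = (\<lambda>x. \<eta>c x 0)" "u0 = (\<lambda>x. uc x 0)"
    using cauchy by (auto simp: SV_cauchy_def SV_classical_def)
  moreover have "C1_line (\<lambda>x. f x 0)" if "C1_strip UNIV T f" for f
    unfolding C1_line_def
    using Dx_has_derivative[OF C1_stripD(1)[OF that], of _ 0] T
      continuous_on_field_x[OF C1_stripD(4)[OF that], of 0 UNIV]
    by (intro exI[of _ "\<lambda>x. Dx UNIV f x 0"]) auto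
  ultimately have C1: "C1_line \<eta>0" "C1_line u0" by auto
  note C1_refl = C1_line_reflect[OF C1(1)] C1_line_reflect[OF C1(2)]
  define a where "a x = - reflected_wave \<mu> (reflect \<eta>0) x" for x
  define b where "b = reflected_wave \<mu> (reflect u0)"
  have datum: "reflected_datum \<mu> (\<eta>0, u0) = (a, b)"
    unfolding a_def b_def by (rule reflected_datum_eq[OF mu C1 assms(4,5)])
  have "C1_line (reflected_wave \<mu> (reflect \<eta>0))" "C1_line b"
    unfolding b_def by (intro C1_line_reflected_wave C1_refl; simp add: reflect_def supp)+
  moreover from this(1) have "C1_line a"
    using C1_line_add_scaled[of "reflected_wave \<mu> (reflect \<eta>0)" "reflected_wave \<mu> (reflect \<eta>0)" "-1" 0]
    by (simp add: a_def[abs_def])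
  ultimately have "\<exists>V. SV_cauchy T (a, b) V"
    by (intro SV_cauchy_exists[OF T])
  moreover have "\<eta>m x t - \<eta>c x t = \<eta>' x t \<and> um x t - uc x t = u' x t"
    if V: "SV_cauchy T (a, b) (\<eta>', u')" and x: "x \<le> 0" and t: "t \<in> {0..T}" for \<eta>' u' x t
  proof -
    have t': "0 \<le> t" "t \<le> T" using t by auto
    note diff = hybrid_minus_cauchy[OF mu T supp assms(6) cauchy x t']
    \<comment> \<open>For x \<le> 0 the right-going invariant of V vanishes, since its data are zero
      at x - t. What remains is (b - a) / 2 at x + t, and the minus sign in a makes this the
      reflected wave of p, by linearity.\<close>
    have "reflected_wave \<mu> (\<lambda>y. (\<eta>0 (- y) + u0 (- y)) / 2) (x + t) = (b (x + t) - a (x + t)) / 2"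
      using reflected_wave_add_scaled[OF C1_line_continuous[OF C1_refl(1)] C1_line_continuous[OF C1_refl(2)],
          of \<mu> "1 / 2" "1 / 2" "x + t"]
      by (simp add: a_def b_def reflect_def add_divide_distrib)
    moreover have "a (x - t) = 0" "b (x - t) = 0"
      using x t' by (simp_all add: a_def b_def reflected_wave_def)
    ultimately show ?thesis
      using SV_cauchy_characteristics[OF V t', of x] diff by (auto simp: field_simps)
  qed
  ultimately show ?thesis
    unfolding datum by blast
qed

end
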